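(* Let $M \in (\mathbf{QP}_{\gg 0})^{k \times s}$, i.e. a $k \times s$ matrix whose entries lie in $\mathbf{QP}_{\gg 0}$. Define the matrix function $D$ by letting $D(n) \in \mathbf{Z}^{k \times s}$ be the Smith normal form of the integer matrix $M(n)$. Then $D \in (\mathbf{QP}_{\gg 0})^{k \times s}$, and there exist $U \in (\mathbf{QP}_{\gg 0})^{k \times k}$ and $V \in (\mathbf{QP}_{\gg 0})^{s \times s}$ such that $U(n)$ and $V(n)$ are unimodular for $n \gg 0$ and $U(n)M(n)V(n) = D(n)$ for $n \gg 0$.
   Context: A function $f$ with integer values defined on all sufficiently large integers is eventually a quasi-polynomial if there exist a positive integer $s$ and polynomials $f_0,\dots,f_{s-1} \in \mathbf{Q}[t]$ such that $f(n) = f_i(n)$ for all sufficiently large $n$ with $n \equiv i \pmod s$; $\mathbf{QP}_{\gg 0}$ denotes the ring of such functions. An integer square matrix is unimodular if its determinant is $\pm 1$. The Smith normal form of an integer matrix $M \in \mathbf{Z}^{k\times s}$ is the unique matrix $D = (\operatorname{diag}(d_1,\dots,d_r,0,\dots,0) \mid \mathbf{0})$ with positive integers $d_i$ satisfying $d_i \mid d_{i+1}$ such that $UMV = D$ for some unimodular integer matrices $U, V$. *)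

theory Defs
  imports "Jordan_Normal_Form.Determinant" "HOL-Computational_Algebra.Polynomial" "HOL-Number_Theory.Cong"
begin

(* A function defined on all sufficiently large integers is represented by an arbitrary
   total extension; membership in QP does not depend on the extension. *)
definition QP :: "(int \<Rightarrow> int) set" where
  "QP = {f. \<exists>s>0. \<exists>p :: nat \<Rightarrow> rat poly. \<forall>\<^sub>F n in at_top. \<forall>i<s.
          [n = int i] (mod int s) \<longrightarrow> rat_of_int (f n) = poly (p i) (rat_of_int n)}"

definition QP_mat :: "nat \<Rightarrow> nat \<Rightarrow> (int \<Rightarrow> int) mat set" where
  "QP_mat k s = {M \<in> carrier_mat k s. \<forall>i<k. \<forall>j<s. M $$ (i, j) \<in> QP}"

definition eval_mat :: "(int \<Rightarrow> int) mat \<Rightarrow> int \<Rightarrow> int mat" where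
  "eval_mat M n = map_mat (\<lambda>f. f n) M"

definition unimodular :: "int mat \<Rightarrow> bool" where
  "unimodular A \<longleftrightarrow> square_mat A \<and> (det A = 1 \<or> det A = -1)"

(* The shape diag(d_1, ..., d_r, 0, ..., 0) padded with zero columns or zero rows to a
   rectangular matrix; indices are shifted to start at 0. *)
definition smith_shape :: "int mat \<Rightarrow> bool" where
  "smith_shape D \<longleftrightarrow>
     (\<exists>r (d :: nat \<Rightarrow> int). r \<le> min (dim_row D) (dim_col D) \<and>
        (\<forall>i<r. d i > 0) \<and> (\<forall>i. Suc i < r \<longrightarrow> d i dvd d (Suc i)) \<and>
        D = mat (dim_row D) (dim_col D) (\<lambda>(i, j). if i = j \<and> i < r then d i else 0))"

definition is_smith_normal_form :: "int mat \<Rightarrow> int mat \<Rightarrow> bool" where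
  "is_smith_normal_form M D \<longleftrightarrow>
     D \<in> carrier_mat (dim_row M) (dim_col M) \<and> smith_shape D \<and>
     (\<exists>U\<in>carrier_mat (dim_row M) (dim_row M). \<exists>V\<in>carrier_mat (dim_col M) (dim_col M).
        unimodular U \<and> unimodular V \<and> U * M * V = D)"

definition smith_normal_form :: "int mat \<Rightarrow> int mat" where
  "smith_normal_form M = (THE D. is_smith_normal_form M D)"

definition smith_mat_fun :: "(int \<Rightarrow> int) mat \<Rightarrow> (int \<Rightarrow> int) mat" where
  "smith_mat_fun M = mat (dim_row M) (dim_col M)
     (\<lambda>(i, j). \<lambda>n. smith_normal_form (eval_mat M n) $$ (i, j))"

end

theory Submission
  imports Defs
begin

text \<open>
  On a residue class the entries of \<open>M\<close> are polynomials over the rationals. Over \<open>\<rat>[t]\<close> some value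
  \<open>x\<^sup>T M y\<close> divides all entries, so after clearing denominators there is a row combination \<open>x\<^sup>T M\<close>
  whose gcd divides \<open>R \<cdot> M(i, j)\<close> for a constant \<open>R\<close>. Quasi-polynomials form a Bezout ring: if
  \<open>A F + B G = R\<close> is constant then \<open>gcd(F(n), G(n))\<close> is periodic and the Bezout coefficients at
  \<open>n mod R\<close> can be corrected. Hence Euclidean reduction steps can be carried out on quasi-polynomials,
  and since the gcd exceeds the gcd of all entries by a factor of at most \<open>R\<close>, a number of steps
  independent of \<open>n\<close> makes it divide all entries. Completing \<open>x\<close> and the corresponding \<open>y\<close> to
  unimodular matrices gives a pivot dividing everything, and one recurses on the remaining block.
  For uniqueness, if \<open>P D = D' W\<close> with \<open>P\<close> unimodular and a prime power divides \<open>d'\<^sub>m\<close> but not \<open>d\<^sub>m\<close>,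
  then \<open>P\<close> has, modulo that prime, a zero block too large for its determinant to be nonzero.
\<close>

subsection \<open>Quasi-polynomials\<close>

text \<open>The condition defining \<open>QP\<close>, restricted to one residue class. For
  \<open>s > 0\<close> and \<open>i \<ge> s\<close> it holds vacuously, so the range of
  \<open>i\<close> can often be left open.\<close>

definition poly_on :: "nat \<Rightarrow> nat \<Rightarrow> (int \<Rightarrow> int) \<Rightarrow> rat poly \<Rightarrow> bool" where
  "poly_on s i f p \<longleftrightarrow>
     (\<forall>\<^sub>F n in at_top. n mod int s = int i \<longrightarrow> rat_of_int (f n) = poly p (rat_of_int n))"

text \<open>There are only finitely many classes, so the common threshold in the definition can be
  traded for one threshold per class.\<close>

lemma QP_iff: "f \<in> QP \<longleftrightarrow> (\<exists>s>0. \<forall>i<s. \<exists>p. poly_on s i f p)"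
proof -
  have *: "[n = int i] (mod int s) \<longleftrightarrow> n mod int s = int i" if "i < s" for n s i
    using that by (simp add: cong_def)
  have **: "(\<forall>\<^sub>F n in at_top. \<forall>i<s. [n = int i] (mod int s) \<longrightarrow> rat_of_int (f n) = poly (p i) (rat_of_int n))
     \<longleftrightarrow> (\<forall>i<s. poly_on s i f (p i))" for s p
  proof -
    have "(\<forall>\<^sub>F n in at_top. \<forall>i\<in>{..<s}. n mod int s = int i \<longrightarrow> rat_of_int (f n) = poly (p i) (rat_of_int n))
     \<longleftrightarrow> (\<forall>i\<in>{..<s}. poly_on s i f (p i))"
      unfolding poly_on_def by (rule eventually_ball_finite_distrib) simp
    then show ?thesis using * by (simp add: Ball_def cong: imp_cong)
  qed
  show ?thesis
    unfolding QP_def mem_Collect_eq ** by metis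
qed

lemma poly_on_refine:
  assumes "poly_on s (i mod s) f p" "s dvd t"
  shows "poly_on t i f p"
proof -
  have "n mod int s = int (i mod s)" if "n mod int t = int i" for n
    using mod_mod_cancel[of "int s" "int t" n] assms(2) that by (simp add: of_nat_mod)
  with assms(1) show ?thesis
    unfolding poly_on_def by (auto elim!: eventually_mono)
qed

text \<open>The product of the individual periods works for all of them, because a class modulo a
  multiple of \<open>s\<close> lies inside one class modulo \<open>s\<close>.\<close>

lemma QP_common_period:
  assumes "finite F" "F \<subseteq> QP"
  shows "\<exists>s>0. \<forall>f\<in>F. \<forall>i<s. \<exists>p. poly_on s i f p"
  using assms
proof (induction F rule: finite_induct)
  case empty
  then show ?case by auto
next
  case (insert f F)
  obtain s where s: "s > 0" "\<forall>f\<in>F. \<forall>i<s. \<exists>p. poly_on s i f p"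
    using insert by auto
  obtain t where t: "t > 0" "\<forall>i<t. \<exists>p. poly_on t i f p"
    using insert by (auto simp: QP_iff)
  have "\<exists>p. poly_on (s * t) i g p" if "g \<in> insert f F" for g i
    using that s t poly_on_refine[of s i g _ "s * t"] poly_on_refine[of t i g _ "s * t"]
    by (metis dvd_triv_left dvd_triv_right insert_iff mod_less_divisor)
  with s t show ?case by (intro exI[of _ "s * t"]) auto
qed

lemma QP_eventually_cong:
  assumes "f \<in> QP" "\<forall>\<^sub>F n in at_top. f n = g n"
  shows "g \<in> QP"
proof -
  have "poly_on s i g p" if "poly_on s i f p" for s i p
    using that assms(2) unfolding poly_on_def
    by eventually_elim auto
  with assms(1) show ?thesis
    unfolding QP_iff by metis
qed

lemma QP_glue:
  assumes "s > 0" "\<And>i. i < s \<Longrightarrow> f i \<in> QP"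
  shows "(\<lambda>n. f (nat (n mod int s)) n) \<in> QP"
proof -
  obtain t where t: "t > 0" "\<forall>g\<in>f ` {..<s}. \<forall>i<t. \<exists>p. poly_on t i g p"
    using QP_common_period[of "f ` {..<s}"] assms(2) by auto
  have "\<exists>p. poly_on (s * t) j (\<lambda>n. f (nat (n mod int s)) n) p" for j
  proof -
    have "j mod s < s" "j mod t < t" using assms(1) t(1) by auto
    with t(2) obtain p where "poly_on t (j mod t) (f (j mod s)) p" by blast
    then have "poly_on (s * t) j (f (j mod s)) p"
      by (rule poly_on_refine) simp
    moreover have "nat (n mod int s) = j mod s" if "n mod int (s * t) = int j" for n
      using mod_mod_cancel[of "int s" "int (s * t)" n] that by (simp flip: of_nat_mod)
    ultimately show ?thesis
      unfolding poly_on_def by (auto elim!: eventually_mono)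
  qed
  with assms(1) t(1) show ?thesis
    unfolding QP_iff by (intro exI[of _ "s * t"]) auto
qed

text \<open>Membership may be tested class by class, where the witness on each class may have a
  period of its own.\<close>

lemma QP_local:
  assumes "s > 0" "\<And>i. i < s \<Longrightarrow> \<exists>g\<in>QP. \<forall>\<^sub>F n in at_top. n mod int s = int i \<longrightarrow> f n = g n"
  shows "f \<in> QP"
proof -
  obtain g where g: "\<And>i. i < s \<Longrightarrow> g i \<in> QP"
    "\<And>i. i < s \<Longrightarrow> \<forall>\<^sub>F n in at_top. n mod int s = int i \<longrightarrow> f n = g i n"
    using assms(2) by metis
  have "\<forall>\<^sub>F n in at_top. \<forall>i\<in>{..<s}. n mod int s = int i \<longrightarrow> f n = g i n"
    using g(2) by (intro eventually_ball_finite) auto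
  then have "\<forall>\<^sub>F n in at_top. g (nat (n mod int s)) n = f n"
  proof eventually_elim
    case (elim n)
    have "nat (n mod int s) < s" "n mod int s = int (nat (n mod int s))"
      using assms(1) by (auto simp: nat_less_iff)
    with elim show ?case by force
  qed
  with QP_glue[OF assms(1) g(1)] show ?thesis
    by (rule QP_eventually_cong)
qed

text \<open>Membership in \<open>QP\<close> only depends on large arguments, so witnesses found class by class and
  eventually can be corrected to be witnesses everywhere.\<close>

lemma QP_choice:
  fixes P :: "int \<Rightarrow> ('j \<Rightarrow> int) \<Rightarrow> bool"
  assumes "s > 0"
    and "\<And>i. i < s \<Longrightarrow> \<exists>w. (\<forall>j. (\<lambda>n. w n j) \<in> QP) \<and>
                 (\<forall>\<^sub>F n in at_top. n mod int s = int i \<longrightarrow> P n (w n))"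
    and "\<And>n. \<exists>v. P n v"
  shows "\<exists>w. (\<forall>j. (\<lambda>n. w n j) \<in> QP) \<and> (\<forall>n. P n (w n))"
proof -
  obtain W where W: "\<And>i j. i < s \<Longrightarrow> (\<lambda>n. W i n j) \<in> QP"
    "\<And>i. i < s \<Longrightarrow> \<forall>\<^sub>F n in at_top. n mod int s = int i \<longrightarrow> P n (W i n)"
    using assms(2) by metis
  \<comment> \<open>The arbitrary choice is made only for \<open>n\<close> below some bound, so it
    does not affect membership in \<open>QP\<close>.\<close>
  define w where "w n = (let v = W (nat (n mod int s)) n in if P n v then v else (SOME v. P n v))" for n
  have "P n (w n)" for n
    using assms(3)[of n] unfolding w_def Let_def by (simp add: some_eq_ex)
  moreover have "(\<lambda>n. w n j) \<in> QP" for j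
  proof (rule QP_local[OF assms(1)])
    fix i assume i: "i < s"
    have "\<forall>\<^sub>F n in at_top. n mod int s = int i \<longrightarrow> w n j = W i n j"
      using W(2)[OF i] by eventually_elim (auto simp: w_def)
    with W(1)[OF i, of j] show "\<exists>g\<in>QP. \<forall>\<^sub>F n in at_top. n mod int s = int i \<longrightarrow> w n j = g n"
      by (intro bexI[of _ "\<lambda>n. W i n j"])
  qed
  ultimately show ?thesis by blast
qed

section \<open>Closure under ring operations and exact division by constants\<close>

lemma QP_const [simp, intro]: "(\<lambda>n. c) \<in> QP"
  unfolding QP_iff poly_on_def
  by (intro exI[of _ 1] conjI allI impI exI[of _ "[:rat_of_int c:]"]) auto

lemma QP_ident [simp, intro]: "(\<lambda>n. n) \<in> QP"
  unfolding QP_iff poly_on_def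
  by (intro exI[of _ 1] conjI allI impI exI[of _ "[:0, 1:]"]) auto

lemma QP_add [simp, intro]:
  assumes "f \<in> QP" "g \<in> QP" shows "(\<lambda>n. f n + g n) \<in> QP"
proof -
  obtain s where s: "s > 0" "\<forall>h\<in>{f, g}. \<forall>i<s. \<exists>p. poly_on s i h p"
    using QP_common_period[of "{f, g}"] assms by auto
  have "\<exists>p. poly_on s i (\<lambda>n. f n + g n) p" if i: "i < s" for i
  proof -
    obtain p q where "poly_on s i f p" "poly_on s i g q" using s i by blast
    then have "poly_on s i (\<lambda>n. f n + g n) (p + q)"
      unfolding poly_on_def by eventually_elim auto
    then show ?thesis ..
  qed
  with s(1) show ?thesis unfolding QP_iff by blast
qed

lemma QP_mult [simp, intro]:
  assumes "f \<in> QP" "g \<in> QP" shows "(\<lambda>n. f n * g n) \<in> QP"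
proof -
  obtain s where s: "s > 0" "\<forall>h\<in>{f, g}. \<forall>i<s. \<exists>p. poly_on s i h p"
    using QP_common_period[of "{f, g}"] assms by auto
  have "\<exists>p. poly_on s i (\<lambda>n. f n * g n) p" if i: "i < s" for i
  proof -
    obtain p q where "poly_on s i f p" "poly_on s i g q" using s i by blast
    then have "poly_on s i (\<lambda>n. f n * g n) (p * q)"
      unfolding poly_on_def by eventually_elim auto
    then show ?thesis ..
  qed
  with s(1) show ?thesis unfolding QP_iff by blast
qed

lemma QP_uminus [simp, intro]: "f \<in> QP \<Longrightarrow> (\<lambda>n. - f n) \<in> QP"
  using QP_mult[OF QP_const[of "-1"], of f] by simp

lemma QP_diff [simp, intro]: "f \<in> QP \<Longrightarrow> g \<in> QP \<Longrightarrow> (\<lambda>n. f n - g n) \<in> QP"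
  using QP_add[OF _ QP_uminus, of f g] by simp

lemma QP_sum [intro]: "(\<And>i. i \<in> I \<Longrightarrow> f i \<in> QP) \<Longrightarrow> (\<lambda>n. \<Sum>i\<in>I. f i n) \<in> QP"
  by (induction I rule: infinite_finite_induct) auto

lemma QP_periodic:
  assumes "R > 0" shows "(\<lambda>n. \<phi> (n mod R)) \<in> QP"
  using QP_glue[of "nat R" "\<lambda>i n. \<phi> (int i)"] assms by simp

text \<open>The rational coefficients absorb the division by \<open>c\<close>; integrality of the
  quotient is built into the type of \<open>q\<close>.\<close>

lemma QP_exact_div_const:
  assumes "f \<in> QP" "c \<noteq> 0" "\<And>n. c * q n = f n"
  shows "q \<in> QP"
proof -
  obtain s where s: "s > 0" "\<forall>i<s. \<exists>p. poly_on s i f p"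
    using assms(1) by (auto simp: QP_iff)
  have "\<exists>p. poly_on s i q p" if i: "i < s" for i
  proof -
    obtain p where "poly_on s i f p" using s i by auto
    then have "poly_on s i q (smult (1 / rat_of_int c) p)"
      unfolding poly_on_def
    proof eventually_elim
      case (elim n)
      have "rat_of_int c * rat_of_int (q n) = rat_of_int (f n)"
        using assms(3)[of n] by (metis of_int_mult)
      with elim assms(2) show ?case by (auto simp: field_simps)
    qed
    then show ?thesis ..
  qed
  with s(1) show ?thesis unfolding QP_iff by blast
qed

lemma QP_int_poly [intro]: "(\<lambda>n. poly F n) \<in> QP" for F :: "int poly"
  by (induction F) auto

section \<open>Eventual signs of polynomials and case distinctions\<close>

lemma eventually_poly_ge_lead_coeff:
  fixes p :: "'a :: linordered_field poly"
  assumes "lead_coeff p > 0"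
  shows "\<exists>N. \<forall>x\<ge>N. poly p x \<ge> lead_coeff p"
  using assms
proof (induction p)
  case 0
  then show ?case by simp
next
  case (pCons a p)
  show ?case
  proof (cases "p = 0")
    case True
    then show ?thesis by auto
  next
    case False
    then have pos: "lead_coeff p > 0" using pCons.prems by (simp split: if_splits)
    with pCons.IH obtain N where N: "\<forall>x\<ge>N. lead_coeff p \<le> poly p x" by blast
    \<comment> \<open>Horner step: beyond this bound \<open>x * poly p x\<close> is at least
      \<open>lead_coeff p + \<bar>a\<bar>\<close>, which absorbs the constant term
      \<open>a\<close>.\<close>
    have "lead_coeff p \<le> a + x * poly p x" if x: "x \<ge> max N (1 + \<bar>a\<bar> / lead_coeff p)" for x
    proof -
      have "(1 + \<bar>a\<bar> / lead_coeff p) * lead_coeff p \<le> x * poly p x"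
        using x pos N by (intro mult_mono) (auto intro: order_trans[of _ "1 + \<bar>a\<bar> / lead_coeff p"])
      moreover have "(1 + \<bar>a\<bar> / lead_coeff p) * lead_coeff p = lead_coeff p + \<bar>a\<bar>"
        using False by (simp add: distrib_right)
      ultimately show ?thesis by linarith
    qed
    then show ?thesis
      using False by (intro exI[of _ "max N (1 + \<bar>a\<bar> / lead_coeff p)"]) simp
  qed
qed

lemma eventually_poly_pos:
  fixes p :: "rat poly"
  assumes "lead_coeff p > 0"
  shows "\<forall>\<^sub>F n in at_top. poly p (rat_of_int n) > 0"
proof -
  obtain N where N: "\<forall>x\<ge>N. poly p x \<ge> lead_coeff p"
    using eventually_poly_ge_lead_coeff[OF assms] by auto
  show ?thesis
    using eventually_ge_at_top[of "\<lceil>N\<rceil>"]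
    by eventually_elim (use N assms in \<open>auto simp: ceiling_le_iff intro: less_le_trans\<close>)
qed

text \<open>On a residue class \<open>f\<close> is eventually a polynomial, whose sign is eventually
  constant; hence the same branch is taken for all large arguments of the class.\<close>

lemma QP_if_pos:
  assumes "f \<in> QP" "g \<in> QP" "h \<in> QP"
  shows "(\<lambda>n. if f n > 0 then g n else h n) \<in> QP"
proof -
  obtain s where s: "s > 0" "\<forall>i<s. \<exists>p. poly_on s i f p"
    using assms(1) by (auto simp: QP_iff)
  show ?thesis
  proof (rule QP_local[OF s(1)])
    fix i assume "i < s"
    then obtain p where p: "poly_on s i f p" using s by auto
    show "\<exists>g'\<in>QP. \<forall>\<^sub>F n in at_top. n mod int s = int i \<longrightarrow> (if f n > 0 then g n else h n) = g' n"
    proof (cases "lead_coeff p > 0")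
      case True
      have "\<forall>\<^sub>F n in at_top. n mod int s = int i \<longrightarrow> f n > 0"
        using p[unfolded poly_on_def] eventually_poly_pos[OF True]
        by eventually_elim (metis of_int_0_less_iff)
      then show ?thesis using assms(2) by (auto elim!: eventually_mono)
    next
      case False
      have "\<forall>\<^sub>F n in at_top. poly p (rat_of_int n) \<le> 0"
      proof (cases "p = 0")
        case False
        with \<open>\<not> lead_coeff p > 0\<close> have "lead_coeff p < 0"
          by (meson leading_coeff_0_iff linorder_neqE)
        then have "lead_coeff (- p) > 0" by simp
        from eventually_poly_pos[OF this] show ?thesis
          by eventually_elim simp
      qed simp
      with p[unfolded poly_on_def] have "\<forall>\<^sub>F n in at_top. n mod int s = int i \<longrightarrow> \<not> f n > 0"
        by eventually_elim (metis of_int_0_less_iff linorder_not_less)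
      then show ?thesis using assms(3) by (auto elim!: eventually_mono)
    qed
  qed
qed

lemma QP_abs [simp, intro]: "f \<in> QP \<Longrightarrow> (\<lambda>n. \<bar>f n\<bar>) \<in> QP"
proof -
  assume f: "f \<in> QP"
  have "(\<lambda>n. if f n > 0 then f n else - f n) \<in> QP"
    using f by (intro QP_if_pos) auto
  also have "(\<lambda>n. if f n > 0 then f n else - f n) = (\<lambda>n. \<bar>f n\<bar>)"
    by auto
  finally show ?thesis .
qed

lemma QP_if_eq:
  assumes "f \<in> QP" "f' \<in> QP" "g \<in> QP" "h \<in> QP"
  shows "(\<lambda>n. if f n = f' n then g n else h n) \<in> QP"
proof -
  have "(\<lambda>n. if \<bar>f n - f' n\<bar> > 0 then h n else g n) \<in> QP"
    using assms by (intro QP_if_pos) auto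
  also have "(\<lambda>n. if \<bar>f n - f' n\<bar> > 0 then h n else g n) = (\<lambda>n. if f n = f' n then g n else h n)"
    by auto
  finally show ?thesis .
qed

subsection \<open>Clearing denominators\<close>

text \<open>One factor \<open>N\<close> serves the whole set, so that products of several of the
  polynomials scale by a known power of \<open>N\<close>.\<close>

lemma clear_denominators:
  fixes S :: "rat poly set"
  assumes "finite S"
  shows "\<exists>N>0. \<forall>p\<in>S. \<exists>F :: int poly. \<forall>n. of_int N * poly p (rat_of_int n) = of_int (poly F n)"
  using assms
proof (induction S rule: finite_induct)
  case empty
  show ?case by (intro exI[of _ 1]) simp
next
  case (insert p S)
  then obtain N where N: "N > 0"
    "\<forall>p\<in>S. \<exists>F :: int poly. \<forall>n. of_int N * poly p (rat_of_int n) = of_int (poly F n)"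
    by auto
  have "\<exists>K>0. \<exists>F :: int poly. \<forall>n. of_int K * poly p (rat_of_int n) = of_int (poly F n)"
  proof (induction p)
    case 0
    show ?case by (intro exI[of _ "1 :: int"] conjI exI[of _ "0 :: int poly"]) auto
  next
    case (pCons a p)
    then obtain K F where K: "K > 0" "\<forall>n. of_int K * poly p (rat_of_int n) = of_int (poly F n)"
      by auto
    obtain x y where a: "y > 0" "a = of_int x / of_int y"
      using quotient_of_div[of a] quotient_of_denom_pos[of a]
      by (cases "quotient_of a") auto
    have "of_int (y * K) * poly (pCons a p) (rat_of_int n) =
      of_int (poly (pCons (x * K) (smult y F)) n)" for n
    proof -
      have "of_int (y * K) * poly (pCons a p) (rat_of_int n) =
        of_int (x * K) + of_int (y * n) * (of_int K * poly p (rat_of_int n))"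
        using a by (simp add: field_simps)
      then show ?thesis using K(2) by (simp add: algebra_simps)
    qed
    moreover have "y * K > 0" using a K by simp
    ultimately show ?case by blast
  qed
  then obtain K F where K: "K > 0" "\<forall>n. of_int K * poly p (rat_of_int n) = of_int (poly F n)"
    by auto
  have "\<exists>F :: int poly. \<forall>n. of_int (K * N) * poly q (rat_of_int n) = of_int (poly F n)"
    if q: "q \<in> insert p S" for q
  proof (cases "q = p")
    case True
    have "\<forall>n. of_int (K * N) * poly q (rat_of_int n) = of_int (poly (smult N F) n)"
      using K(2) True by (simp add: mult.commute mult.left_commute)
    then show ?thesis ..
  next
    case False
    with q N(2) obtain G where "\<forall>n. of_int N * poly q (rat_of_int n) = of_int (poly G n)"
      by auto
    then have "\<forall>n. of_int (K * N) * poly q (rat_of_int n) = of_int (poly (smult K G) n)"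
      by (simp add: mult.assoc)
    then show ?thesis ..
  qed
  moreover have "K * N > 0" using K N by simp
  ultimately show ?case by blast
qed

text \<open>Values of an integer polynomial modulo \<open>R\<close> depend only on the argument
  modulo \<open>R\<close>. This fails for rational coefficients, which is why denominators are
  cleared first.\<close>

lemma int_poly_diff_dvd: "n - m dvd poly F n - poly F m" for F :: "int poly"
proof (induction F)
  case (pCons a F)
  have "poly (pCons a F) n - poly (pCons a F) m = n * (poly F n - poly F m) + (n - m) * poly F m"
    by (simp add: algebra_simps)
  with pCons.IH show ?case by (metis dvd_add dvd_mult dvd_triv_left)
qed simp

subsection \<open>Bilinear forms over a Euclidean ring\<close>

text \<open>The form x^T A y. Vectors are functions on \<open>nat\<close> of which only the first
  \<open>k\<close> and \<open>s\<close> values count. It is used both over \<open>rat poly\<close>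
  and over \<open>int\<close>.\<close>

definition bilin :: "nat \<Rightarrow> nat \<Rightarrow> (nat \<Rightarrow> nat \<Rightarrow> 'a) \<Rightarrow> (nat \<Rightarrow> 'a) \<Rightarrow> (nat \<Rightarrow> 'a) \<Rightarrow> 'a :: comm_ring_1" where
  "bilin k s A x y = (\<Sum>i<k. \<Sum>j<s. x i * A i j * y j)"

lemma bilin_lin:
  "bilin k s A (\<lambda>i. x i + c * x' i) y = bilin k s A x y + c * bilin k s A x' y"
  "bilin k s A x (\<lambda>i. y i + c * y' i) = bilin k s A x y + c * bilin k s A x y'"
  unfolding bilin_def sum_distrib_left sum.distrib[symmetric]
  by (intro sum.cong refl; simp only: algebra_simps)+

lemma bilin_unit:
  assumes "i < k" "j < s"
  shows "bilin k s A (\<lambda>a. of_bool (a = i)) (\<lambda>b. of_bool (b = j)) = A i j"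
proof -
  have "bilin k s A (\<lambda>a. of_bool (a = i)) (\<lambda>b. of_bool (b = j)) =
      (\<Sum>a<k. if a = i then (\<Sum>b<s. if b = j then A a b else 0) else 0)"
    unfolding bilin_def by (intro sum.cong) (auto intro!: sum.cong)
  then show ?thesis using assms by simp
qed

text \<open>A nonzero value \<open>B(x, y)\<close> of minimal Euclidean size divides \<open>B(x, -)\<close> and \<open>B(-, y)\<close>. Given
  \<open>u\<close>, subtracting a multiple of \<open>x\<close> we may assume \<open>B(u, y) = 0\<close>; then \<open>B(x + u, y) = B(x, y)\<close>
  is again minimal, hence divides \<open>B(x + u, -)\<close> and therefore \<open>B(u, -)\<close>.\<close>

lemma bilin_value_dvd_all:
  fixes A :: "nat \<Rightarrow> nat \<Rightarrow> 'a :: euclidean_ring"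
  shows "\<exists>x y. \<forall>i<k. \<forall>j<s. bilin k s A x y dvd A i j"
proof (cases "\<exists>x y. bilin k s A x y \<noteq> 0")
  case False
  then have "A i j = 0" if "i < k" "j < s" for i j
    using bilin_unit[OF that, of A] by metis
  then show ?thesis by simp
next
  case True
  let ?B = "bilin k s A"
  from True obtain x\<^sub>0 y\<^sub>0 where "?B x\<^sub>0 y\<^sub>0 \<noteq> 0" by blast
  then obtain z where z: "?B (fst z) (snd z) \<noteq> 0"
    "\<forall>w. ?B (fst w) (snd w) \<noteq> 0 \<longrightarrow> euclidean_size (?B (fst z) (snd z)) \<le> euclidean_size (?B (fst w) (snd w))"
    using ex_has_least_nat[of "\<lambda>z. ?B (fst z) (snd z) \<noteq> 0" "(x\<^sub>0, y\<^sub>0)" "\<lambda>z. euclidean_size (?B (fst z) (snd z))"]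
    by auto
  define x y where "x = fst z" "y = snd z"
  have xy: "?B x y \<noteq> 0" using z by (simp add: x_y_def)
  have min: "euclidean_size (?B x y) \<le> euclidean_size (?B u v)" if "?B u v \<noteq> 0" for u v
    using z(2)[rule_format, of "(u, v)"] that by (simp add: x_y_def)
  \<comment> \<open>A nonzero remainder modulo the minimal value would be a smaller nonzero value of
    the form.\<close>
  have dvd: "?B x y dvd b" if "?B u v = b mod ?B x y" for b u v
  proof (rule ccontr)
    assume "\<not> ?B x y dvd b"
    then have "?B u v \<noteq> 0" using that by (simp add: mod_eq_0_iff_dvd)
    from min[OF this] mod_size_less[OF xy, of b] show False
      unfolding that by simp
  qed
  have right: "?B x y dvd ?B u v'" if "?B u v = ?B x y" for u v v'
  proof (rule dvd)
    show "?B u (\<lambda>j. v' j + - (?B u v' div ?B x y) * v j) = ?B u v' mod ?B x y"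
      unfolding bilin_lin that by (simp add: minus_div_mult_eq_mod)
  qed
  have left: "?B x y dvd ?B u y" for u
  proof (rule dvd)
    show "?B (\<lambda>j. u j + - (?B u y div ?B x y) * x j) y = ?B u y mod ?B x y"
      unfolding bilin_lin by (simp add: minus_div_mult_eq_mod)
  qed
  have "?B x y dvd ?B u v" for u v
  proof -
    obtain a where a: "?B u y = ?B x y * a" using left by (auto elim: dvdE)
    define u' where "u' = (\<lambda>i. u i + - a * x i)"
    define z where "z = (\<lambda>i. x i + 1 * u' i)"
    have "?B z y = ?B x y"
      unfolding z_def u'_def bilin_lin a by (simp add: algebra_simps)
    then have "?B x y dvd ?B z v" by (rule right)
    moreover have "?B u v = ?B z v + (a - 1) * ?B x v"
      unfolding z_def u'_def bilin_lin by (simp add: algebra_simps)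
    ultimately show ?thesis using right[of x y v] by (metis dvd_add dvd_mult)
  qed
  then have "?B x y dvd A i j" if "i < k" "j < s" for i j
    using bilin_unit[OF that, of A] by metis
  then show ?thesis by blast
qed

subsection \<open>Quasi-polynomials form a Bezout ring\<close>

text \<open>Asking for coprime cofactors instead of a gcd covers \<open>x = y = 0\<close>, where
  \<open>d = 0\<close>. It supplies solutions at those arguments that a construction valid only
  eventually leaves out.\<close>

lemma int_bezout_cofactors:
  fixes x y :: int
  shows "\<exists>d u v a b. x = a * d \<and> y = b * d \<and> u * a + v * b = 1"
proof (cases "x = 0 \<and> y = 0")
  case True
  then show ?thesis by (intro exI[of _ 0] exI[of _ 1]) auto
next
  case False
  obtain u v where uv: "u * x + v * y = gcd x y" using bezout_int by blast
  obtain a b where ab: "x = a * gcd x y" "y = b * gcd x y"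
    by (metis gcd_dvd1 gcd_dvd2 dvd_def mult.commute)
  have "(u * a + v * b) * gcd x y = 1 * gcd x y"
    using uv ab by (metis distrib_right mult.assoc mult_1)
  then have "u * a + v * b = 1" using False by simp
  with ab show ?thesis by metis
qed

text \<open>The gcd \<open>e n\<close> of the values divides \<open>R\<close>, so it is periodic, and Bezout coefficients for
  \<open>n mod R\<close> are off by a multiple of \<open>R\<close> at \<open>n\<close>, which the given relation repairs.\<close>

lemma QP_bezout_int_poly:
  fixes F G A B :: "int poly"
  assumes R: "R > 0" and rel: "\<And>n. poly A n * poly F n + poly B n * poly G n = R"
  shows "\<exists>u\<in>QP. \<exists>v\<in>QP. \<exists>a\<in>QP. \<exists>b\<in>QP. \<exists>e. \<forall>n.
    poly F n = a n * e n \<and> poly G n = b n * e n \<and> u n * a n + v n * b n = 1"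
proof -
  have "\<forall>m. \<exists>u v. u * poly F m + v * poly G m = gcd (poly F m) (poly G m)"
    using bezout_int by blast
  then obtain U V where UV: "\<And>m. U m * poly F m + V m * poly G m = gcd (poly F m) (poly G m)"
    by metis
  define E where "E m = gcd (poly F m) (poly G m)" for m
  have E_R: "E m dvd R" for m
    unfolding E_def rel[of m, symmetric] by (intro dvd_add dvd_mult) auto
  have E0: "E m \<noteq> 0" for m using E_R[of m] R by auto
  have cong: "R dvd poly H n - poly H (n mod R)" for H :: "int poly" and n
    using int_poly_diff_dvd[of n "n mod R" H] by (metis dvd_minus_mod dvd_trans)
  \<comment> \<open>\<open>E (n mod R)\<close> divides \<open>R\<close>, and \<open>R\<close>
    divides the difference of the two values of \<open>H\<close>.\<close>
  have lift: "E (n mod R) dvd poly H n" if "E (n mod R) dvd poly H (n mod R)" for H :: "int poly" and n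
    using that cong[of H n] E_R[of "n mod R"] by (metis dvd_diff_commute dvd_trans dvd_add_right_iff diff_add_cancel)
  define e where "e n = E (n mod R)" for n
  define a where "a n = poly F n div e n" for n
  define b where "b n = poly G n div e n" for n
  define w where "w n = (U (n mod R) * poly F n + V (n mod R) * poly G n - e n) div R" for n
  define u where "u n = U (n mod R) - w n * poly A n" for n
  define v where "v n = V (n mod R) - w n * poly B n" for n
  have a: "poly F n = a n * e n" and b: "poly G n = b n * e n" for n
    using lift[of n F] lift[of n G] by (auto simp: a_def b_def e_def E_def)
  have w: "R * w n = U (n mod R) * poly F n + V (n mod R) * poly G n - e n" for n
  proof -
    have "U (n mod R) * poly F n + V (n mod R) * poly G n - e n =
       U (n mod R) * (poly F n - poly F (n mod R)) + V (n mod R) * (poly G n - poly G (n mod R))"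
      unfolding e_def E_def UV[symmetric] by (simp add: algebra_simps)
    also have "R dvd \<dots>" using cong by (intro dvd_add dvd_mult)
    finally show ?thesis by (simp add: w_def)
  qed
  have "u n * a n + v n * b n = 1" for n
  proof -
    have "(u n * a n + v n * b n) * e n = u n * poly F n + v n * poly G n"
      unfolding a b by (simp add: algebra_simps)
    also have "\<dots> = U (n mod R) * poly F n + V (n mod R) * poly G n -
        w n * (poly A n * poly F n + poly B n * poly G n)"
      unfolding u_def v_def by (simp add: algebra_simps)
    also have "\<dots> = 1 * e n" using w[of n] unfolding rel by (simp add: algebra_simps)
    finally show ?thesis using E0 unfolding e_def by (metis mult_right_cancel)
  qed
  moreover have per: "(\<lambda>n. \<phi> (n mod R)) \<in> QP" for \<phi> using QP_periodic[OF R] .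
  have R': "R = e n * (R div e n)" for n using E_R unfolding e_def by simp
  \<comment> \<open>\<open>R div e n\<close> is periodic in \<open>n\<close>, so
    \<open>R * a n = poly F n * (R div e n)\<close> is a quasi-polynomial and only a division by the
    constant \<open>R\<close> remains.\<close>
  have "a \<in> QP"
  proof (rule QP_exact_div_const)
    show "(\<lambda>n. poly F n * (R div e n)) \<in> QP"
      unfolding e_def using per[of "\<lambda>m. R div E m"] by auto
    show "R * a n = poly F n * (R div e n)" for n
      unfolding a by (subst R'[of n]) (simp add: mult_ac)
  qed (use R in simp)
  moreover have "b \<in> QP"
  proof (rule QP_exact_div_const)
    show "(\<lambda>n. poly G n * (R div e n)) \<in> QP"
      unfolding e_def using per[of "\<lambda>m. R div E m"] by auto
    show "R * b n = poly G n * (R div e n)" for n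
      unfolding b by (subst R'[of n]) (simp add: mult_ac)
  qed (use R in simp)
  moreover have "w \<in> QP"
  proof (rule QP_exact_div_const[OF _ _ w])
    show "(\<lambda>n. U (n mod R) * poly F n + V (n mod R) * poly G n - e n) \<in> QP"
      unfolding e_def using per[of U] per[of V] per[of E] by (intro QP_diff QP_add QP_mult QP_int_poly)
  qed (use R in simp)
  then have "u \<in> QP" "v \<in> QP"
    unfolding u_def v_def using per[of U] per[of V]
    by (auto intro!: QP_diff QP_mult QP_int_poly)
  ultimately show ?thesis using a b by blast
qed

text \<open>On a class, write the two polynomials as multiples \<open>h * p'\<close> and
  \<open>h * q'\<close> of a combination \<open>h = \<alpha> * p + \<beta> * q\<close>. For
  \<open>h \<noteq> 0\<close> this gives \<open>\<alpha> * p' + \<beta> * q' = 1\<close>; after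
  clearing denominators, \<open>QP_bezout_int_poly\<close> applies to the integer versions of
  \<open>p'\<close> and \<open>q'\<close>.\<close>

lemma QP_bezout:
  assumes f: "f \<in> QP" and g: "g \<in> QP"
  shows "\<exists>d\<in>QP. \<exists>u\<in>QP. \<exists>v\<in>QP. \<exists>a\<in>QP. \<exists>b\<in>QP. \<forall>n.
    f n = a n * d n \<and> g n = b n * d n \<and> u n * a n + v n * b n = 1"
proof -
  define P :: "int \<Rightarrow> (nat \<Rightarrow> int) \<Rightarrow> bool" where
    "P n w \<longleftrightarrow> f n = w 3 * w 0 \<and> g n = w 4 * w 0 \<and> w 1 * w 3 + w 2 * w 4 = 1" for n w
  \<comment> \<open>The five unknowns are packed into one function on \<open>nat\<close>, the form
    in which \<open>QP_choice\<close> handles witnesses.\<close>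
  define tuple :: "int \<Rightarrow> int \<Rightarrow> int \<Rightarrow> int \<Rightarrow> int \<Rightarrow> nat \<Rightarrow> int" where
    "tuple d u v a b j = (if j = 0 then d else if j = 1 then u else if j = 2 then v
        else if j = 3 then a else b)" for d u v a b j
  have P_tuple: "P n (tuple d u v a b) \<longleftrightarrow> f n = a * d \<and> g n = b * d \<and> u * a + v * b = 1"
    for n d u v a b by (simp add: P_def tuple_def)
  have QP_tuple: "(\<lambda>n. tuple (d n) (u n) (v n) (a n) (b n) j) \<in> QP"
    if "d \<in> QP" "u \<in> QP" "v \<in> QP" "a \<in> QP" "b \<in> QP" for d u v a b j
    using that by (cases "j = 0"; cases "j = 1"; cases "j = 2"; cases "j = 3"; simp add: tuple_def)
  obtain s where s: "s > 0" "\<forall>h\<in>{f, g}. \<forall>i<s. \<exists>p. poly_on s i h p"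
    using QP_common_period[of "{f, g}"] f g by auto
  have "\<exists>w. (\<forall>j. (\<lambda>n. w n j) \<in> QP) \<and> (\<forall>n. P n (w n))"
  proof (rule QP_choice[OF s(1)])
    fix n show "\<exists>w. P n w"
      using int_bezout_cofactors[of "f n" "g n"] P_tuple by metis
  next
    fix i assume "i < s"
    then obtain p q where pq: "poly_on s i f p" "poly_on s i g q" using s by blast
    \<comment> \<open>The 2 x 1 matrix with entries \<open>p\<close> and \<open>q\<close>: a value
      of its bilinear form dividing both entries is a gcd in Bezout form.\<close>
    define X where "X i j = (if i = 0 then p else q)" for i j :: nat
    obtain x y where xy: "\<forall>i<2. \<forall>j<1. bilin 2 1 X x y dvd X i j"
      using bilin_value_dvd_all[of 2 1 X] by blast
    define h where "h = bilin 2 1 X x y"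
    define \<alpha> \<beta> where "\<alpha> = x 0 * y 0" "\<beta> = x 1 * y 0"
    have h: "h = \<alpha> * p + \<beta> * q"
      by (simp add: h_def bilin_def X_def numeral_2_eq_2 \<alpha>_\<beta>_def algebra_simps)
    have "h dvd p" "h dvd q"
      using xy[rule_format, of 0 0] xy[rule_format, of 1 0] by (simp_all add: h_def X_def)
    then obtain p' q' where p': "p = h * p'" "q = h * q'" by (auto elim!: dvdE)
    show "\<exists>w. (\<forall>j. (\<lambda>n. w n j) \<in> QP) \<and> (\<forall>\<^sub>F n in at_top. n mod int s = int i \<longrightarrow> P n (w n))"
    proof (cases "h = 0")
      case True
      then have 0: "p = 0" "q = 0" using p' by auto
      have "\<forall>\<^sub>F n in at_top. n mod int s = int i \<longrightarrow> P n (tuple 0 1 0 1 0)"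
        using pq unfolding poly_on_def P_tuple by eventually_elim (simp add: 0)
      then show ?thesis
        using QP_tuple[of "\<lambda>_. 0" "\<lambda>_. 1" "\<lambda>_. 0" "\<lambda>_. 1" "\<lambda>_. 0"]
        by (intro exI[of _ "\<lambda>n. tuple 0 1 0 1 0"]) auto
    next
      case False
      have "h * (\<alpha> * p' + \<beta> * q') = h * 1" using h p' by (simp add: algebra_simps)
      then have one: "\<alpha> * p' + \<beta> * q' = 1" using False by simp
      obtain N where N: "N > 0" "\<forall>r\<in>{\<alpha>, \<beta>, p', q'}. \<exists>F :: int poly. \<forall>n.
          of_int N * poly r (rat_of_int n) = of_int (poly F n)"
        using clear_denominators[of "{\<alpha>, \<beta>, p', q'}"] by auto
      obtain A where A: "\<And>n. of_int N * poly \<alpha> (rat_of_int n) = of_int (poly A n)" using N by blast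
      obtain B where B: "\<And>n. of_int N * poly \<beta> (rat_of_int n) = of_int (poly B n)" using N by blast
      obtain F where F: "\<And>n. of_int N * poly p' (rat_of_int n) = of_int (poly F n)" using N by blast
      obtain G where G: "\<And>n. of_int N * poly q' (rat_of_int n) = of_int (poly G n)" using N by blast
      have rel: "poly A n * poly F n + poly B n * poly G n = N * N" for n
      proof -
        have "rat_of_int (poly A n * poly F n + poly B n * poly G n) =
            of_int (N * N) * poly (\<alpha> * p' + \<beta> * q') (rat_of_int n)"
          by (simp flip: A B F G add: algebra_simps)
        then show ?thesis unfolding one by (simp flip: of_int_mult)
      qed
      obtain u v a b e where QP: "u \<in> QP" "v \<in> QP" "a \<in> QP" "b \<in> QP"
        and eq: "\<And>n. poly F n = a n * e n \<and> poly G n = b n * e n \<and> u n * a n + v n * b n = 1"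
        using QP_bezout_int_poly[OF _ rel] N(1) mult_pos_pos[OF N(1) N(1)] by blast
      \<comment> \<open>With \<open>H\<close> the value of \<open>h\<close>, one has
        \<open>N * f = H * a * e\<close> and \<open>N * g = H * b * e\<close>, so this combination
        satisfies \<open>N * d = H * e\<close>. It is visibly an integer and a
        quasi-polynomial.\<close>
      define d where "d n = u n * f n + v n * g n" for n
      have "\<forall>\<^sub>F n in at_top. n mod int s = int i \<longrightarrow> P n (tuple (d n) (u n) (v n) (a n) (b n))"
        using pq unfolding poly_on_def
      proof eventually_elim
        case (elim n)
        show ?case
        proof
          assume n: "n mod int s = int i"
          define H where "H = poly h (rat_of_int n)"
          have Nf: "of_int N * rat_of_int (f n) = H * (of_int (a n) * of_int (e n))"
            using elim n F[of n] eq[of n] by (simp add: p' H_def mult.left_commute)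
          have Ng: "of_int N * rat_of_int (g n) = H * (of_int (b n) * of_int (e n))"
            using elim n G[of n] eq[of n] by (simp add: p' H_def mult.left_commute)
          have one: "rat_of_int (u n) * of_int (a n) + of_int (v n) * of_int (b n) = 1"
            using eq[of n] by (metis of_int_add of_int_mult of_int_1)
          have Nd: "of_int N * rat_of_int (d n) = H * of_int (e n)"
          proof -
            have "of_int N * rat_of_int (d n) =
              of_int (u n) * (of_int N * rat_of_int (f n)) + of_int (v n) * (of_int N * rat_of_int (g n))"
              by (simp add: d_def algebra_simps)
            also have "\<dots> = (rat_of_int (u n) * of_int (a n) + of_int (v n) * of_int (b n)) * (H * of_int (e n))"
              unfolding Nf Ng by (simp add: algebra_simps)
            finally show ?thesis using one by simp
          qed
          have "of_int N * rat_of_int (f n) = of_int N * rat_of_int (a n * d n)"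
            using Nf Nd by (simp add: mult_ac)
          moreover have "of_int N * rat_of_int (g n) = of_int N * rat_of_int (b n * d n)"
            using Ng Nd by (simp add: mult_ac)
          ultimately show "P n (tuple (d n) (u n) (v n) (a n) (b n))"
            using N(1) eq[of n] unfolding P_tuple by (simp del: of_int_mult)
        qed
      qed
      moreover have "d \<in> QP" unfolding d_def using QP f g by auto
      ultimately show ?thesis using QP QP_tuple
        by (intro exI[of _ "\<lambda>n. tuple (d n) (u n) (v n) (a n) (b n)"]) auto
    qed
  qed
  then obtain w where w: "\<And>j. (\<lambda>n. w n j) \<in> QP" "\<And>n. P n (w n)" by blast
  have "\<exists>d. d \<in> QP \<and> (\<exists>u. u \<in> QP \<and> (\<exists>v. v \<in> QP \<and> (\<exists>a. a \<in> QP \<and> (\<exists>b. b \<in> QP \<and> (\<forall>n.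
    f n = a n * d n \<and> g n = b n * d n \<and> u n * a n + v n * b n = 1)))))"
    by (rule exI[of _ "\<lambda>n. w n 0"], rule conjI[OF w(1)], rule exI[of _ "\<lambda>n. w n 1"], rule conjI[OF w(1)],
        rule exI[of _ "\<lambda>n. w n 2"], rule conjI[OF w(1)], rule exI[of _ "\<lambda>n. w n 3"], rule conjI[OF w(1)],
        rule exI[of _ "\<lambda>n. w n 4"], rule conjI[OF w(1)]) (use w(2) in \<open>simp add: P_def\<close>)
  then show ?thesis by blast
qed

text \<open>Where \<open>d n\<close> is nonzero, divisibility forces the coprime cofactor
  \<open>a n\<close> of \<open>f n\<close> to be a unit, hence its own inverse, and the quotient is
  \<open>a n * b n\<close>. Where \<open>d n = 0\<close>, both values vanish.\<close>

lemma QP_exact_div: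
  assumes "f \<in> QP" "g \<in> QP" "\<And>n. f n dvd g n"
  shows "\<exists>q\<in>QP. \<forall>n. g n = q n * f n"
proof -
  obtain d u v a b where QP: "d \<in> QP" "u \<in> QP" "v \<in> QP" "a \<in> QP" "b \<in> QP"
    and eq: "\<And>n. f n = a n * d n \<and> g n = b n * d n \<and> u n * a n + v n * b n = 1"
    using QP_bezout[OF assms(1,2)] by blast
  have "g n = (a n * b n) * f n" for n
  proof (cases "d n = 0")
    case False
    with assms(3)[of n] eq[of n] have "a n dvd b n" by simp
    then have "a n dvd 1" using eq[of n] by (metis dvd_add dvd_mult dvd_triv_right)
    then have "\<bar>a n\<bar> = 1" by simp
    then have "a n * a n = 1" by (metis abs_mult_self_eq mult_1)
    then show ?thesis using eq[of n] by (simp add: mult_ac)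
  qed (use eq[of n] in simp)
  then show ?thesis using QP by (intro bexI[of _ "\<lambda>n. a n * b n"]) auto
qed

text \<open>Adjoining \<open>x k\<close> by the two-term case multiplies the old coefficients by
  \<open>u\<close> and gives \<open>x k\<close> the coefficient \<open>v\<close>.\<close>

lemma QP_bezout_vector:
  fixes k :: nat
  assumes "\<And>j. x j \<in> QP"
  shows "\<exists>y g. (\<forall>j. y j \<in> QP) \<and> g \<in> QP \<and> (\<forall>n. g n = (\<Sum>j<k. x j n * y j n)) \<and>
     (\<forall>n. \<forall>j<k. g n dvd x j n)"
proof (induction k)
  case 0
  show ?case by (intro exI[of _ "\<lambda>_ _. 0"]) auto
next
  case (Suc k)
  then obtain y g where IH: "\<And>j. y j \<in> QP" "g \<in> QP" "\<And>n. g n = (\<Sum>j<k. x j n * y j n)"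
    "\<And>n j. j < k \<Longrightarrow> g n dvd x j n" by blast
  obtain d u v a b where QP: "d \<in> QP" "u \<in> QP" "v \<in> QP" "a \<in> QP" "b \<in> QP"
    and eq: "\<And>n. g n = a n * d n \<and> x k n = b n * d n \<and> u n * a n + v n * b n = 1"
    using QP_bezout[OF IH(2) assms[of k]] by blast
  define y' where "y' j = (if j < k then (\<lambda>n. y j n * u n) else v)" for j
  have "y' j \<in> QP" for j using IH QP by (simp add: y'_def)
  moreover have "d n = (\<Sum>j<Suc k. x j n * y' j n)" for n
  proof -
    have "d n = u n * g n + v n * x k n"
      using eq[of n] by (metis distrib_right mult.assoc mult_1)
    then show ?thesis by (simp add: y'_def IH(3) sum_distrib_left mult_ac)
  qed
  moreover have "d n dvd x j n" if "j < Suc k" for n j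
    using that eq[of n] IH(4)[of j n] by (auto simp: less_Suc_eq elim: dvd_mult_right)
  ultimately show ?case using QP(1) by (intro exI[of _ y'] exI[of _ d]) blast
qed

subsection \<open>A row combination whose gcd divides all entries\<close>

text \<open>The gcd of the entries of the row x^T A, that is, the nonnegative generator of the ideal
  of all values \<open>bilin k s A x y\<close> with \<open>x\<close> fixed.\<close>

definition row_gcd :: "nat \<Rightarrow> nat \<Rightarrow> (nat \<Rightarrow> nat \<Rightarrow> int) \<Rightarrow> (nat \<Rightarrow> int) \<Rightarrow> int" where
  "row_gcd k s A x = Gcd ((\<lambda>j. \<Sum>i<k. x i * A i j) ` {..<s})"

lemma dvd_row_gcd_iff: "e dvd row_gcd k s A x \<longleftrightarrow> (\<forall>j<s. e dvd (\<Sum>i<k. x i * A i j))"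
  unfolding row_gcd_def by (auto simp: dvd_Gcd_iff)

lemma row_gcd_nonneg [simp]: "row_gcd k s A x \<ge> 0"
  unfolding row_gcd_def by simp

lemma bilin_eq_sum_columns: "bilin k s A x y = (\<Sum>j<s. (\<Sum>i<k. x i * A i j) * y j)"
  unfolding bilin_def sum_distrib_right by (rule sum.swap)

lemma row_gcd_dvd_bilin: "row_gcd k s A x dvd bilin k s A x y"
  unfolding bilin_eq_sum_columns
  using dvd_row_gcd_iff[of "row_gcd k s A x" k s A x] by (auto intro!: dvd_mult2 intro: dvd_sum[where A = "{..<s}"])

lemma bilin_comb:
  "bilin k s A (\<lambda>i. p * x i + q * x' i) y = p * bilin k s A x y + q * bilin k s A x' y"
  unfolding bilin_def sum_distrib_left sum.distrib[symmetric]
  by (intro sum.cong refl) (simp only: algebra_simps)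

lemma sum_unit_mult: "(i :: nat) < k \<Longrightarrow> (\<Sum>l<k. of_bool (l = i) * f l) = (f i :: int)"
proof -
  assume "i < k"
  have "(\<Sum>l<k. of_bool (l = i) * f l) = (\<Sum>l<k. if l = i then f l else 0)"
    by (intro sum.cong) auto
  also have "\<dots> = f i" using \<open>i < k\<close> by (subst sum.delta) auto
  finally show ?thesis .
qed

definition QP_vec :: "(int \<Rightarrow> nat \<Rightarrow> int) \<Rightarrow> bool" where
  "QP_vec x \<longleftrightarrow> (\<forall>i. (\<lambda>n. x n i) \<in> QP)"

context
  fixes k s :: nat and A :: "int \<Rightarrow> nat \<Rightarrow> nat \<Rightarrow> int"
  assumes A: "\<And>i j. (\<lambda>n. A n i j) \<in> QP"
begin

lemma QP_row_gcd_eq_bilin: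
  assumes "QP_vec x"
  shows "\<exists>y. QP_vec y \<and> (\<lambda>n. row_gcd k s (A n) (x n)) \<in> QP \<and>
    (\<forall>n. row_gcd k s (A n) (x n) = bilin k s (A n) (x n) (y n))"
proof -
  define r where "r j n = (\<Sum>i<k. x n i * A n i j)" for j n
  have "r j \<in> QP" for j unfolding r_def using assms A by (auto simp: QP_vec_def)
  then obtain y g where y: "\<And>j. y j \<in> QP" and g: "g \<in> QP" "\<And>n. g n = (\<Sum>j<s. r j n * y j n)"
    "\<And>n j. j < s \<Longrightarrow> g n dvd r j n"
    using QP_bezout_vector[of r s] by blast
  have row_gcd: "row_gcd k s (A n) (x n) = \<bar>g n\<bar>" for n
  proof (rule zdvd_antisym_nonneg)
    show "\<bar>g n\<bar> dvd row_gcd k s (A n) (x n)"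
      using g(3)[of _ n] by (simp add: dvd_row_gcd_iff r_def)
    show "row_gcd k s (A n) (x n) dvd \<bar>g n\<bar>"
      using row_gcd_dvd_bilin[of k s "A n" "x n" "\<lambda>j. y j n"]
      unfolding bilin_eq_sum_columns g(2) r_def by simp
  qed auto
  \<comment> \<open>The Bezout vector yields the gcd up to sign; flipping it according to the sign
    of \<open>g\<close> stays within \<open>QP\<close>.\<close>
  define y' where "y' n j = (if g n > 0 then y j n else - y j n)" for n j
  have "\<bar>g n\<bar> = (\<Sum>j<s. r j n * y' n j)" for n
    using g(2)[of n, symmetric] by (cases "g n > 0") (simp_all add: y'_def sum_negf)
  moreover have "QP_vec y'"
    unfolding QP_vec_def y'_def using y g(1) by (auto intro!: QP_if_pos)
  ultimately show ?thesis
    unfolding row_gcd bilin_eq_sum_columns r_def using QP_abs[OF g(1)] by (intro exI[of _ y']) blast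
qed

text \<open>Both \<open>x1\<close> and \<open>x2\<close> below have the value \<open>d = gcd(B(x, y), B(e, y))\<close> at \<open>y\<close>, as \<open>x2 - x1\<close> is annihilated by
  \<open>y\<close>. If neither improves the gcd of \<open>x\<close>, it divides the two rows and hence row \<open>i\<close>.\<close>

lemma row_gcd_step_row:
  assumes x: "QP_vec x" and i: "i < k"
  shows "\<exists>x'. QP_vec x' \<and> (\<forall>n. row_gcd k s (A n) (x' n) dvd row_gcd k s (A n) (x n) \<and>
    (row_gcd k s (A n) (x' n) = row_gcd k s (A n) (x n) \<longrightarrow>
      (\<forall>j<s. row_gcd k s (A n) (x n) dvd A n i j)))"
proof -
  let ?C = "\<lambda>x n. row_gcd k s (A n) (x n)"
  obtain y where y: "QP_vec y" and Cx: "?C x \<in> QP" "\<And>n. ?C x n = bilin k s (A n) (x n) (y n)"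
    using QP_row_gcd_eq_bilin[OF x] by blast
  define e :: "nat \<Rightarrow> int" where "e l = of_bool (l = i)" for l
  define h where "h n = bilin k s (A n) e (y n)" for n
  have h: "h \<in> QP" unfolding h_def bilin_def
    using A y by (intro QP_sum QP_mult) (auto simp: QP_vec_def)
  obtain d u v a b where QP: "d \<in> QP" "u \<in> QP" "v \<in> QP" "a \<in> QP" "b \<in> QP"
    and eq: "\<And>n. ?C x n = a n * d n \<and> h n = b n * d n \<and> u n * a n + v n * b n = 1"
    using QP_bezout[OF Cx(1) h] by blast
  define x1 where "x1 n = (\<lambda>l. u n * x n l + v n * e l)" for n
  \<comment> \<open>Thus \<open>x2 - x1\<close> is \<open>e - b n * x1\<close>, whose value at
    \<open>y n\<close> is \<open>h n - b n * d n = 0\<close>.\<close>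
  define x2 where "x2 n = (\<lambda>l. 1 * e l + (1 - b n) * x1 n l)" for n
  have x1: "QP_vec x1" using x QP by (simp add: QP_vec_def x1_def)
  then have x2: "QP_vec x2" using QP by (simp add: QP_vec_def x2_def)
  have B1: "bilin k s (A n) (x1 n) (y n) = d n" for n
  proof -
    have "bilin k s (A n) (x1 n) (y n) = u n * ?C x n + v n * h n"
      unfolding x1_def bilin_comb h_def Cx(2) by (rule refl)
    also have "\<dots> = u n * (a n * d n) + v n * (b n * d n)"
      using eq[of n] by simp
    also have "\<dots> = (u n * a n + v n * b n) * d n"
      by (simp only: algebra_simps)
    finally show ?thesis using eq[of n] by simp
  qed
  have B2: "bilin k s (A n) (x2 n) (y n) = d n" for n
  proof -
    have "bilin k s (A n) (x2 n) (y n) = h n + (1 - b n) * d n"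
      unfolding x2_def bilin_comb h_def by (simp add: B1)
    then show ?thesis using eq[of n] by (simp add: algebra_simps)
  qed
  have dvd: "?C x1 n dvd ?C x n" "?C x2 n dvd ?C x n" for n
    using row_gcd_dvd_bilin[of k s "A n" "x1 n" "y n"] row_gcd_dvd_bilin[of k s "A n" "x2 n" "y n"]
      eq[of n] unfolding B1 B2 by auto
  have row: "?C x n dvd A n i j" if "?C x1 n = ?C x n" "?C x2 n = ?C x n" "j < s" for n j
  proof -
    have "(\<Sum>l<k. x2 n l * A n l j) = (\<Sum>l<k. e l * A n l j) + (1 - b n) * (\<Sum>l<k. x1 n l * A n l j)"
      unfolding x2_def sum_distrib_left sum.distrib[symmetric]
      by (intro sum.cong refl) (simp add: algebra_simps)
    then have "A n i j = (\<Sum>l<k. x2 n l * A n l j) - (1 - b n) * (\<Sum>l<k. x1 n l * A n l j)"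
      using sum_unit_mult[OF i, of "\<lambda>l. A n l j"] by (simp add: e_def)
    moreover have "?C x n dvd (\<Sum>l<k. x1 n l * A n l j)" "?C x n dvd (\<Sum>l<k. x2 n l * A n l j)"
      using that dvd_row_gcd_iff by (metis dvd_refl)+
    ultimately show ?thesis by (metis dvd_diff dvd_mult)
  qed
  \<comment> \<open>Use \<open>x1\<close> where it improves the gcd and \<open>x2\<close> elsewhere.
    If \<open>x'\<close> brings no improvement at \<open>n\<close>, then neither \<open>x1\<close>
    nor \<open>x2\<close> does.\<close>
  define x' where "x' n l = (if ?C x1 n = ?C x n then x2 n l else x1 n l)" for n l
  have "QP_vec x'"
    unfolding QP_vec_def x'_def
    using x1 x2 Cx(1) QP_row_gcd_eq_bilin[OF x1] by (auto simp: QP_vec_def intro!: QP_if_eq)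
  moreover have "x' n = (if ?C x1 n = ?C x n then x2 n else x1 n)" for n
    unfolding x'_def by auto
  ultimately show ?thesis
    using dvd row by (intro exI[of _ x']) auto
qed

text \<open>The rows are treated one after the other. The successive gcds divide each other, so a
  gcd that is unchanged at the end was unchanged at every stage.\<close>

lemma row_gcd_step:
  assumes x: "QP_vec x"
  shows "\<exists>x'. QP_vec x' \<and> (\<forall>n. row_gcd k s (A n) (x' n) dvd row_gcd k s (A n) (x n) \<and>
    (row_gcd k s (A n) (x' n) = row_gcd k s (A n) (x n) \<longrightarrow>
      (\<forall>i<k. \<forall>j<s. row_gcd k s (A n) (x n) dvd A n i j)))"
proof -
  let ?C = "\<lambda>x n. row_gcd k s (A n) (x n)"
  have "\<exists>x'. QP_vec x' \<and> (\<forall>n. ?C x' n dvd ?C x n \<and>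
    (?C x' n = ?C x n \<longrightarrow> (\<forall>i<m. \<forall>j<s. ?C x n dvd A n i j)))" if "m \<le> k" for m
    using that
  proof (induction m)
    case 0
    then show ?case using x by (intro exI[of _ x]) auto
  next
    case (Suc m)
    then obtain x1 where x1: "QP_vec x1" "\<And>n. ?C x1 n dvd ?C x n"
      "\<And>n i j. ?C x1 n = ?C x n \<Longrightarrow> i < m \<Longrightarrow> j < s \<Longrightarrow> ?C x n dvd A n i j"
      using Suc_leD[OF Suc.prems] by blast
    obtain x2 where x2: "QP_vec x2" "\<And>n. ?C x2 n dvd ?C x1 n"
      "\<And>n j. ?C x2 n = ?C x1 n \<Longrightarrow> j < s \<Longrightarrow> ?C x1 n dvd A n m j"
      using row_gcd_step_row[OF x1(1), of m] Suc_le_lessD[OF Suc.prems] by blast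
    have "?C x n dvd A n i j" if "?C x2 n = ?C x n" "i < Suc m" "j < s" for n i j
    proof -
      have "?C x1 n = ?C x n"
        using x1(2)[of n] x2(2)[of n] that(1) by (intro zdvd_antisym_nonneg) auto
      with x1(3)[of n i j] x2(3)[of n j] that show ?thesis by (auto simp: less_Suc_eq)
    qed
    moreover have "?C x2 n dvd ?C x n" for n using x1(2)[of n] x2(2)[of n] by (rule dvd_trans[rotated])
    ultimately show ?case using x2(1) by (intro exI[of _ x2]) auto
  qed
  from this[of k] show ?thesis by blast
qed

text \<open>Induction on the bound for the factor \<open>t\<close> by which the row gcd exceeds the
  gcd of all entries. A step that changes the gcd lowers \<open>t\<close>; a step that does not
  shows \<open>t = 1\<close>. The bound \<open>r\<close> is independent of \<open>n\<close>, so
  finitely many steps serve all \<open>n\<close> at once.\<close>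

lemma row_gcd_reduce:
  assumes "QP_vec x" and "r > 0"
    and "\<And>n. \<exists>t>0. t \<le> int r \<and>
      row_gcd k s (A n) (x n) = t * Gcd ((\<lambda>(i, j). A n i j) ` ({..<k} \<times> {..<s}))"
  shows "\<exists>x'. QP_vec x' \<and> (\<forall>n. \<forall>i<k. \<forall>j<s. row_gcd k s (A n) (x' n) dvd A n i j)"
  using assms
proof (induction r arbitrary: x)
  case 0
  then show ?case by simp
next
  case (Suc r)
  let ?C = "\<lambda>x n. row_gcd k s (A n) (x n)"
  define c where "c n = Gcd ((\<lambda>(i, j). A n i j) ` ({..<k} \<times> {..<s}))" for n
  have c0: "c n \<ge> 0" for n by (simp add: c_def)
  have c_dvd: "c n dvd A n i j" if "i < k" "j < s" for n i j
    unfolding c_def using that by (intro Gcd_dvd) auto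
  have dvd_c: "e dvd c n" if "\<And>i j. i < k \<Longrightarrow> j < s \<Longrightarrow> e dvd A n i j" for e n
    unfolding c_def using that by (auto simp: dvd_Gcd_iff)
  have c_C: "c n dvd ?C z n" for z n
    unfolding dvd_row_gcd_iff using c_dvd by (auto intro!: dvd_sum)
  have bound: "\<exists>t>0. t \<le> int (Suc r) \<and> ?C x n = t * c n" for n
    using Suc.prems(3)[of n] unfolding c_def .
  show ?case
  proof (cases "r = 0")
    case True
    have "?C x n = c n" for n
    proof -
      obtain t where "t > 0" "t \<le> int (Suc r)" "?C x n = t * c n" using bound[of n] by blast
      moreover from this True have "t = 1" by simp
      ultimately show ?thesis by simp
    qed
    then show ?thesis using Suc.prems(1) c_dvd by auto
  next
    case False
    obtain x' where x': "QP_vec x'" "\<And>n. ?C x' n dvd ?C x n"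
      "\<And>n i j. ?C x' n = ?C x n \<Longrightarrow> i < k \<Longrightarrow> j < s \<Longrightarrow> ?C x n dvd A n i j"
      using row_gcd_step[OF Suc.prems(1)] by blast
    have "\<exists>t>0. t \<le> int r \<and> ?C x' n = t * c n" for n
    \<comment> \<open>For \<open>c n = 0\<close> every row gcd vanishes and any \<open>t\<close>
      fits. An unchanged gcd divides all entries and hence equals \<open>c n\<close>. In both cases
      \<open>t = 1\<close> is taken.\<close>
    proof (cases "c n = 0 \<or> ?C x' n = ?C x n")
      case True
      have "?C x' n = c n"
      proof (cases "c n = 0")
        case True
        then show ?thesis using c_C[of n x'] by simp
      next
        case False
        then have eq: "?C x' n = ?C x n" using True by simp
        then have "?C x n dvd c n" by (intro dvd_c x'(3))
        then show ?thesis
          using c_C[of n x] c0[of n] unfolding eq by (intro zdvd_antisym_nonneg) auto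
      qed
      then show ?thesis using False by (intro exI[of _ 1]) auto
    next
      case False
      then have c: "c n > 0" using c0[of n] by linarith
      obtain t where t: "t > 0" "t \<le> int (Suc r)" "?C x n = t * c n" using bound[of n] by blast
      obtain t' where t': "?C x' n = t' * c n" using c_C[of n x'] by (metis dvd_def mult.commute)
      have Cx: "?C x n > 0" using t c by simp
      have "?C x' n \<noteq> 0" using x'(2)[of n] Cx by auto
      then have "?C x' n > 0" using row_gcd_nonneg[of k s "A n" "x' n"] by linarith
      then have "t' > 0" unfolding t' using c by (simp add: zero_less_mult_iff)
      moreover have "?C x' n < ?C x n" using zdvd_imp_le[OF x'(2)[of n] Cx] False by linarith
      then have "t' < t" unfolding t(3) t' using c by simp
      ultimately show ?thesis using t t' by (intro exI[of _ t']) auto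
    qed
    then show ?thesis
      using Suc.IH[OF x'(1)] False unfolding c_def by blast
  qed
qed

end

text \<open>Over the rational polynomials some value \<open>bilin k s P \<alpha> \<beta>\<close>
  divides every \<open>P i j\<close>, with cofactor \<open>H i j\<close>. Scaling \<alpha>, \<beta>
  and \<open>H i j\<close> by a common denominator \<open>N\<close> shows that an integer value of
  the form divides \<open>N * N * N * A n i j\<close>; the row gcd divides that value.\<close>

lemma row_gcd_bounded_class:
  assumes "\<And>i j. i < k \<Longrightarrow> j < s \<Longrightarrow> poly_on t c (\<lambda>n. A n i j) (P i j)"
  shows "\<exists>R>0. \<exists>x. QP_vec x \<and> (\<forall>\<^sub>F n in at_top. n mod int t = int c \<longrightarrow>
    (\<forall>i<k. \<forall>j<s. row_gcd k s (A n) (x n) dvd R * A n i j))"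
proof -
  obtain \<alpha> \<beta> where "\<forall>i<k. \<forall>j<s. bilin k s P \<alpha> \<beta> dvd P i j"
    using bilin_value_dvd_all[of k s P] by blast
  then have "\<forall>i j. \<exists>h. i < k \<longrightarrow> j < s \<longrightarrow> P i j = bilin k s P \<alpha> \<beta> * h"
    by (auto simp: dvd_def)
  then obtain H where H: "\<And>i j. i < k \<Longrightarrow> j < s \<Longrightarrow> P i j = bilin k s P \<alpha> \<beta> * H i j"
    by metis
  define S where "S = \<alpha> ` {..<k} \<union> \<beta> ` {..<s} \<union> (\<lambda>(i, j). H i j) ` ({..<k} \<times> {..<s})"
  have "finite S" by (simp add: S_def)
  have S: "\<alpha> i \<in> S" "\<beta> j \<in> S" "H i j \<in> S" if "i < k" "j < s" for i j
    using that by (force simp: S_def)+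
  from \<open>finite S\<close> obtain N where N: "N > 0"
    "\<forall>p\<in>S. \<exists>F :: int poly. \<forall>n. of_int N * poly p (rat_of_int n) = of_int (poly F n)"
    using clear_denominators by blast
  then obtain cl :: "rat poly \<Rightarrow> int poly"
    where cl: "\<And>p n. p \<in> S \<Longrightarrow> of_int N * poly p (rat_of_int n) = of_int (poly (cl p) n)"
    by metis
  define x where "x n i = poly (cl (\<alpha> i)) n" for n i
  define y where "y n j = poly (cl (\<beta> j)) n" for n j
  have "QP_vec x" by (auto simp: QP_vec_def x_def)
  moreover have "\<forall>\<^sub>F n in at_top. \<forall>i\<in>{..<k}. \<forall>j\<in>{..<s}. n mod int t = int c \<longrightarrow>
      rat_of_int (A n i j) = poly (P i j) (rat_of_int n)"
    using assms unfolding poly_on_def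
    by (intro eventually_ball_finite[OF finite_lessThan] ballI) simp
  then have "\<forall>\<^sub>F n in at_top. n mod int t = int c \<longrightarrow>
    (\<forall>i<k. \<forall>j<s. row_gcd k s (A n) (x n) dvd N * N * N * A n i j)"
  proof eventually_elim
    case (elim n)
    show ?case
    proof (intro impI allI)
      fix i j assume n: "n mod int t = int c" and ij: "i < k" "j < s"
      have AP: "rat_of_int (A n i j) = poly (P i j) (rat_of_int n)" if "i < k" "j < s" for i j
        using elim n that by simp
      have "rat_of_int (bilin k s (A n) (x n) (y n)) =
        (\<Sum>i<k. \<Sum>j<s. (of_int N * of_int N) * poly (\<alpha> i * P i j * \<beta> j) (rat_of_int n))"
        unfolding bilin_def of_int_sum
      proof (intro sum.cong refl)
        fix i j assume "i \<in> {..<k}" "j \<in> {..<s}"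
        then show "rat_of_int (x n i * A n i j * y n j) =
            (of_int N * of_int N) * poly (\<alpha> i * P i j * \<beta> j) (rat_of_int n)"
          using AP[of i j] S[of i j] by (simp add: x_def y_def flip: cl)
      qed
      also have "\<dots> = (of_int N * of_int N) * poly (bilin k s P \<alpha> \<beta>) (rat_of_int n)"
        by (simp add: bilin_def poly_sum sum_distrib_left)
      finally have "rat_of_int (bilin k s (A n) (x n) (y n) * poly (cl (H i j)) n) =
          of_int (N * N) * poly (bilin k s P \<alpha> \<beta>) (rat_of_int n) * (of_int N * poly (H i j) (rat_of_int n))"
        using cl[OF S(3)[OF ij], of n] by simp
      also have "\<dots> = rat_of_int (N * N * N * A n i j)"
        using AP[OF ij] H[OF ij] by (simp add: mult_ac)
      finally have "bilin k s (A n) (x n) (y n) * poly (cl (H i j)) n = N * N * N * A n i j"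
        by (simp only: of_int_eq_iff)
      then show "row_gcd k s (A n) (x n) dvd N * N * N * A n i j"
        using row_gcd_dvd_bilin[of k s "A n" "x n" "y n"] by (metis dvd_mult2)
    qed
  qed
  moreover have "N * N * N > 0" using N by simp
  ultimately show ?thesis by blast
qed

lemma row_gcd_bounded:
  assumes A: "\<And>i j. (\<lambda>n. A n i j) \<in> QP"
  shows "\<exists>R>0. \<exists>x. QP_vec x \<and> (\<forall>n. \<forall>i<k. \<forall>j<s. row_gcd k s (A n) (x n) dvd R * A n i j)"
proof -
  obtain t where t: "t > 0"
    "\<forall>f\<in>(\<lambda>(i, j). \<lambda>n. A n i j) ` ({..<k} \<times> {..<s}). \<forall>c<t. \<exists>p. poly_on t c f p"
  proof -
    have "(\<lambda>(i, j). \<lambda>n. A n i j) ` ({..<k} \<times> {..<s}) \<subseteq> QP"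
      using A by auto
    then show ?thesis
      using QP_common_period[of "(\<lambda>(i, j). \<lambda>n. A n i j) ` ({..<k} \<times> {..<s})"] that by blast
  qed
  have "\<exists>R>0. \<exists>x. QP_vec x \<and> (\<forall>\<^sub>F n in at_top. n mod int t = int c \<longrightarrow>
    (\<forall>i<k. \<forall>j<s. row_gcd k s (A n) (x n) dvd R * A n i j))" if c: "c < t" for c
  proof -
    have "\<forall>i j. \<exists>p. i < k \<longrightarrow> j < s \<longrightarrow> poly_on t c (\<lambda>n. A n i j) p"
      using t(2) c by auto
    then obtain P where "\<And>i j. i < k \<Longrightarrow> j < s \<Longrightarrow> poly_on t c (\<lambda>n. A n i j) (P i j)"
      by metis
    then show ?thesis by (rule row_gcd_bounded_class)
  qed
  then have "\<forall>c. \<exists>R. c < t \<longrightarrow> R > 0 \<and> (\<exists>x. QP_vec x \<and> (\<forall>\<^sub>F n in at_top. n mod int t = int c \<longrightarrow>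
    (\<forall>i<k. \<forall>j<s. row_gcd k s (A n) (x n) dvd R * A n i j)))"
    by blast
  from choice[OF this] obtain R where R: "\<And>c. c < t \<Longrightarrow> R c > 0" "\<And>c. c < t \<Longrightarrow> \<exists>x. QP_vec x \<and>
    (\<forall>\<^sub>F n in at_top. n mod int t = int c \<longrightarrow> (\<forall>i<k. \<forall>j<s. row_gcd k s (A n) (x n) dvd R c * A n i j))"
    by blast
  \<comment> \<open>The product of the constants of the finitely many classes is a multiple of each,
    hence a constant valid on all of them.\<close>
  define R' where "R' = (\<Prod>c<t. R c)"
  have "\<exists>x. (\<forall>j. (\<lambda>n. x n j) \<in> QP) \<and> (\<forall>n. \<forall>i<k. \<forall>j<s. row_gcd k s (A n) (x n) dvd R' * A n i j)"
  proof (rule QP_choice[OF t(1)])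
    fix c assume c: "c < t"
    then have "R c dvd R'" unfolding R'_def by (intro dvd_prodI) auto
    then have lift: "row_gcd k s (A n) x dvd R' * A n i j" if "row_gcd k s (A n) x dvd R c * A n i j" for n x i j
      using that by (meson dvd_trans mult_dvd_mono dvd_refl)
    obtain x where x: "QP_vec x" "\<forall>\<^sub>F n in at_top. n mod int t = int c \<longrightarrow>
        (\<forall>i<k. \<forall>j<s. row_gcd k s (A n) (x n) dvd R c * A n i j)"
      using R(2)[OF c] by blast
    from x(2) have "\<forall>\<^sub>F n in at_top. n mod int t = int c \<longrightarrow>
        (\<forall>i<k. \<forall>j<s. row_gcd k s (A n) (x n) dvd R' * A n i j)"
      by eventually_elim (use lift in blast)
    with x(1) show "\<exists>x. (\<forall>j. (\<lambda>n. x n j) \<in> QP) \<and> (\<forall>\<^sub>F n in at_top. n mod int t = int c \<longrightarrow>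
        (\<forall>i<k. \<forall>j<s. row_gcd k s (A n) (x n) dvd R' * A n i j))"
      unfolding QP_vec_def by blast
  next
    fix n
    \<comment> \<open>The lemma on bilinear values, now over the integers, provides a solution at
      each single \<open>n\<close>.\<close>
    obtain x y where "\<forall>i<k. \<forall>j<s. bilin k s (A n) x y dvd A n i j"
      using bilin_value_dvd_all[of k s "A n"] by blast
    then show "\<exists>x. \<forall>i<k. \<forall>j<s. row_gcd k s (A n) x dvd R' * A n i j"
      using row_gcd_dvd_bilin[of k s "A n" x y] by (meson dvd_trans dvd_mult)
  qed
  moreover have "R' > 0" unfolding R'_def using R(1) by (intro prod_pos) auto
  ultimately show ?thesis unfolding QP_vec_def by blast
qed

text \<open>The row gcd lies between the gcd \<open>c\<close> of all entries and
  \<open>R * c\<close> in the divisibility order, so for \<open>c \<noteq> 0\<close> their ratio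
  divides \<open>R\<close>. This is the uniform bound that the reduction needs.\<close>

lemma row_gcd_dvd_all:
  assumes A: "\<And>i j. (\<lambda>n. A n i j) \<in> QP"
  shows "\<exists>x. QP_vec x \<and> (\<forall>n. \<forall>i<k. \<forall>j<s. row_gcd k s (A n) (x n) dvd A n i j)"
proof -
  obtain R x where R: "R > 0" and x: "QP_vec x"
    "\<And>n i j. i < k \<Longrightarrow> j < s \<Longrightarrow> row_gcd k s (A n) (x n) dvd R * A n i j"
    using row_gcd_bounded[of A k s, OF A] by blast
  have "\<exists>t>0. t \<le> int (nat R) \<and>
      row_gcd k s (A n) (x n) = t * Gcd ((\<lambda>(i, j). A n i j) ` ({..<k} \<times> {..<s}))" for n
  proof -
    define c where "c = Gcd ((\<lambda>(i, j). A n i j) ` ({..<k} \<times> {..<s}))"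
    let ?C = "row_gcd k s (A n) (x n)"
    have "c dvd A n i j" if "i < k" "j < s" for i j
      unfolding c_def using that by (intro Gcd_dvd) auto
    then have "c dvd ?C"
      unfolding dvd_row_gcd_iff by (auto intro!: dvd_sum)
    then obtain t where t: "?C = t * c" by (metis dvd_def mult.commute)
    have "?C dvd R * c"
    proof -
      have "?C dvd Gcd ((*) R ` (\<lambda>(i, j). A n i j) ` ({..<k} \<times> {..<s}))"
        using x(2)[of _ _ n] by (auto simp: dvd_Gcd_iff)
      also have "\<dots> = normalize (R * c)"
        unfolding c_def by (rule Gcd_mult)
      finally show ?thesis by simp
    qed
    show ?thesis
    proof (cases "c = 0")
      case True
      then show ?thesis using t R by (intro exI[of _ 1]) (auto simp: c_def)
    next
      case False
      then have c: "c > 0" by (simp add: c_def order_less_le)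
      have "t dvd R" using \<open>?C dvd R * c\<close> c unfolding t by simp
      then have "t \<noteq> 0" "t \<le> R" using R by (auto intro: zdvd_imp_le)
      moreover have "t \<ge> 0" using row_gcd_nonneg[of k s "A n" "x n"] c unfolding t
        by (simp add: zero_le_mult_iff)
      ultimately show ?thesis using t R by (intro exI[of _ t]) (auto simp: c_def)
    qed
  qed
  with row_gcd_reduce[OF A x(1), of "nat R" k s] R show ?thesis by auto
qed

subsection \<open>Quasi-polynomial families of matrices\<close>

text \<open>Families of integer matrices instead of matrices of functions as in
  \<open>QP_mat\<close>, so that products and determinants are those of ordinary integer matrices at
  each \<open>n\<close>.\<close>

definition qp_mat :: "nat \<Rightarrow> nat \<Rightarrow> (int \<Rightarrow> int mat) \<Rightarrow> bool" where
  "qp_mat k s F \<longleftrightarrow> (\<forall>n. F n \<in> carrier_mat k s) \<and> (\<forall>i<k. \<forall>j<s. (\<lambda>n. F n $$ (i, j)) \<in> QP)"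

text \<open>Demanded at every \<open>n\<close>, not just eventually; this is possible because the
  Bezout identities above hold at every \<open>n\<close>.\<close>

definition qp_unimodular :: "nat \<Rightarrow> (int \<Rightarrow> int mat) \<Rightarrow> bool" where
  "qp_unimodular k U \<longleftrightarrow> qp_mat k k U \<and> (\<forall>n. det (U n) = 1 \<or> det (U n) = -1)"

lemma qp_matD: "qp_mat k s F \<Longrightarrow> F n \<in> carrier_mat k s"
  by (simp add: qp_mat_def)

lemma qp_mat_entry: "qp_mat k s F \<Longrightarrow> i < k \<Longrightarrow> j < s \<Longrightarrow> (\<lambda>n. F n $$ (i, j)) \<in> QP"
  by (simp add: qp_mat_def)

lemma index_mult_mat_sum:
  assumes "A \<in> carrier_mat k m" "B \<in> carrier_mat m s" "i < k" "j < s"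
  shows "(A * B) $$ (i, j) = (\<Sum>l<m. A $$ (i, l) * B $$ (l, j))"
  using assms by (auto simp: scalar_prod_def lessThan_atLeast0 intro!: sum.cong)

lemma qp_mat_mult:
  assumes "qp_mat k m F" "qp_mat m s G"
  shows "qp_mat k s (\<lambda>n. F n * G n)"
  unfolding qp_mat_def
proof (intro conjI allI impI)
  show "F n * G n \<in> carrier_mat k s" for n
    using assms by (intro mult_carrier_mat[of _ k m]) (auto simp: qp_mat_def)
  fix i j assume ij: "i < k" "j < s"
  have "(\<lambda>n. (F n * G n) $$ (i, j)) = (\<lambda>n. \<Sum>l<m. F n $$ (i, l) * G n $$ (l, j))"
    using index_mult_mat_sum[OF qp_matD[OF assms(1)] qp_matD[OF assms(2)] ij] by (rule ext)
  also have "\<dots> \<in> QP"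
    using assms ij by (intro QP_sum QP_mult qp_mat_entry) auto
  finally show "(\<lambda>n. (F n * G n) $$ (i, j)) \<in> QP" .
qed

lemma qp_mat_const: "M \<in> carrier_mat k s \<Longrightarrow> qp_mat k s (\<lambda>_. M)"
  by (auto simp: qp_mat_def)

lemma qp_matI:
  assumes "\<And>i j. i < k \<Longrightarrow> j < s \<Longrightarrow> (\<lambda>n. f n i j) \<in> QP"
  shows "qp_mat k s (\<lambda>n. mat k s (\<lambda>(i, j). f n i j))"
  using assms by (auto simp: qp_mat_def)

lemma qp_mat_four_block:
  assumes "qp_mat k s A" "qp_mat k s' B" "qp_mat k' s C" "qp_mat k' s' D"
  shows "qp_mat (k + k') (s + s') (\<lambda>n. four_block_mat (A n) (B n) (C n) (D n))"
  unfolding qp_mat_def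
proof (intro conjI allI impI)
  show "four_block_mat (A n) (B n) (C n) (D n) \<in> carrier_mat (k + k') (s + s')" for n
    using assms by (auto simp: qp_mat_def)
  fix i j assume ij: "i < k + k'" "j < s + s'"
  have dims: "dim_row (A n) = k" "dim_col (A n) = s" "dim_row (D n) = k'" "dim_col (D n) = s'" for n
    using assms by (auto simp: qp_mat_def)
  show "(\<lambda>n. four_block_mat (A n) (B n) (C n) (D n) $$ (i, j)) \<in> QP"
    using ij assms by (cases "i < k"; cases "j < s") (simp_all add: dims qp_mat_entry)
qed

lemma qp_unimodular_one: "qp_unimodular k (\<lambda>_. 1\<^sub>m k)"
  by (simp add: qp_unimodular_def qp_mat_const)

lemma qp_unimodular_mult:
  assumes "qp_unimodular k U" "qp_unimodular k V"
  shows "qp_unimodular k (\<lambda>n. U n * V n)"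
proof -
  have "det (U n * V n) = det (U n) * det (V n)" for n
    using assms by (intro det_mult[of _ k]) (auto simp: qp_unimodular_def qp_matD)
  with assms show ?thesis
    unfolding qp_unimodular_def by (auto simp: qp_mat_mult) (metis mult_1 mult_minus1 minus_minus)+
qed

lemma qp_unimodular_transpose:
  assumes "qp_unimodular k U"
  shows "qp_unimodular k (\<lambda>n. transpose_mat (U n))"
proof -
  have c: "U n \<in> carrier_mat k k" for n using assms by (simp add: qp_unimodular_def qp_matD)
  then have "dim_row (U n) = k" "dim_col (U n) = k" for n by auto
  with assms c show ?thesis
    by (auto simp: qp_unimodular_def qp_mat_def det_transpose[OF c])
qed

lemma qp_unimodular_block_diag:
  assumes "qp_unimodular k U" "qp_unimodular s V"
  shows "qp_unimodular (k + s) (\<lambda>n. four_block_mat (U n) (0\<^sub>m k s) (0\<^sub>m s k) (V n))"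
proof -
  have "det (four_block_mat (U n) (0\<^sub>m k s) (0\<^sub>m s k) (V n)) = det (U n) * det (V n)" for n
    using assms by (intro det_four_block_mat_upper_right_zero) (auto simp: qp_unimodular_def qp_matD)
  moreover have "qp_mat (k + s) (k + s) (\<lambda>n. four_block_mat (U n) (0\<^sub>m k s) (0\<^sub>m s k) (V n))"
    using assms by (intro qp_mat_four_block qp_mat_const) (auto simp: qp_unimodular_def)
  ultimately show ?thesis
    using assms unfolding qp_unimodular_def by simp (metis mult_1 mult_minus1 minus_minus)
qed

lemma det_2x2_block:
  fixes a b c d :: int
  shows "det (four_block_mat (mat 1 1 (\<lambda>_. a)) (mat 1 1 (\<lambda>_. b)) (mat 1 1 (\<lambda>_. c)) (mat 1 1 (\<lambda>_. d)))
    = a * d - b * c"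
proof -
  let ?m = "\<lambda>x :: int. mat 1 1 (\<lambda>_ :: nat \<times> nat. x)"
  have m: "?m x * ?m y = ?m (x * y)" for x y
    by (rule eq_matI) (auto simp: scalar_prod_def)
  have "?m a * ?m d - ?m b * ?m c = ?m (a * d - b * c)"
    unfolding m by (rule eq_matI) auto
  moreover have "det (four_block_mat (?m a) (?m b) (?m c) (?m d)) = det (?m a * ?m d - ?m b * ?m c)"
    by (rule det_four_block_mat[of _ 1]) (simp_all only: m mult.commute[of c d] mat_carrier)
  ultimately show ?thesis by (simp add: det_single)
qed

text \<open>Only a multiple of \<open>x\<close> is required to be the first row, which also covers
  zero vectors. The tail of \<open>x\<close> is \<open>c\<close> times the first row of some
  \<open>U\<close>; a Bezout relation for \<open>x n 0\<close> and \<open>c n\<close> then gives a 2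
  x 2 matrix that combines row 0 with that first row.\<close>

lemma unimodular_completion:
  assumes "QP_vec x"
  shows "\<exists>U c. qp_unimodular (Suc k) U \<and> c \<in> QP \<and> (\<forall>n. \<forall>j<Suc k. x n j = c n * U n $$ (0, j))"
  using assms
proof (induction k arbitrary: x)
  case 0
  then show ?case
    by (intro exI[of _ "\<lambda>_. 1\<^sub>m (Suc 0)"] exI[of _ "\<lambda>n. x n 0"])
       (simp add: qp_unimodular_one QP_vec_def)
next
  case (Suc k)
  have "QP_vec (\<lambda>n j. x n (Suc j))" using Suc.prems by (simp add: QP_vec_def)
  from Suc.IH[OF this] obtain U c where U: "qp_unimodular (Suc k) U" and c: "c \<in> QP"
    "\<And>n j. j < Suc k \<Longrightarrow> x n (Suc j) = c n * U n $$ (0, j)"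
    by blast
  have x0: "(\<lambda>n. x n 0) \<in> QP" using Suc.prems by (simp add: QP_vec_def)
  obtain d u v a b where QP: "d \<in> QP" "u \<in> QP" "v \<in> QP" "a \<in> QP" "b \<in> QP"
    and eq: "\<And>n. x n 0 = a n * d n \<and> c n = b n * d n \<and> u n * a n + v n * b n = 1"
    using QP_bezout[OF x0 c(1)] by blast
  let ?m = "\<lambda>x :: int. mat 1 1 (\<lambda>_ :: nat \<times> nat. x)"
  \<comment> \<open>Its determinant is \<open>u n * a n + v n * b n = 1\<close>, and its first row
    holds the cofactors of \<open>x n 0\<close> and \<open>c n\<close>.\<close>
  define E2 where "E2 n = four_block_mat (?m (a n)) (?m (b n)) (?m (- v n)) (?m (u n))" for n
  define E where "E n = four_block_mat (E2 n) (0\<^sub>m 2 k) (0\<^sub>m k 2) (1\<^sub>m k)" for n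
  define F where "F n = four_block_mat (1\<^sub>m 1) (0\<^sub>m 1 (Suc k)) (0\<^sub>m (Suc k) 1) (U n)" for n
  have qm: "qp_mat 1 1 (\<lambda>n. ?m (f n))" if "f \<in> QP" for f
    using qp_matI[of 1 1 "\<lambda>n _ _. f n"] that by (simp add: case_prod_unfold)
  have "qp_mat (1 + 1) (1 + 1) E2"
    unfolding E2_def using QP by (intro qp_mat_four_block qm) auto
  moreover have "det (E2 n) = 1" for n
    unfolding E2_def det_2x2_block using eq[of n] by (simp add: mult.commute)
  ultimately have E2: "qp_unimodular 2 E2" by (simp add: qp_unimodular_def numeral_2_eq_2)
  then have E: "qp_unimodular (Suc (Suc k)) E"
    using qp_unimodular_block_diag[OF E2 qp_unimodular_one[of k]] by (simp add: E_def[abs_def])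
  have F: "qp_unimodular (Suc (Suc k)) F"
    using qp_unimodular_block_diag[OF qp_unimodular_one[of 1] U] by (simp add: F_def[abs_def])
  have "x n j = d n * (E n * F n) $$ (0, j)" if j: "j < Suc (Suc k)" for n j
  proof -
    have carr: "E n \<in> carrier_mat (Suc (Suc k)) (Suc (Suc k))" "F n \<in> carrier_mat (Suc (Suc k)) (Suc (Suc k))"
      "E2 n \<in> carrier_mat 2 2" "U n \<in> carrier_mat (Suc k) (Suc k)"
      using E F E2 U by (auto simp: qp_unimodular_def qp_matD)
    have "(E n * F n) $$ (0, j) = (\<Sum>l<Suc (Suc k). E n $$ (0, l) * F n $$ (l, j))"
      using carr j by (intro index_mult_mat_sum) auto
    also have "\<dots> = E n $$ (0, 0) * F n $$ (0, j) + E n $$ (0, 1) * F n $$ (1, j) +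
        (\<Sum>l<k. E n $$ (0, Suc (Suc l)) * F n $$ (Suc (Suc l), j))"
      by (simp only: sum.lessThan_Suc_shift One_nat_def add.assoc)
    also have "(\<Sum>l<k. E n $$ (0, Suc (Suc l)) * F n $$ (Suc (Suc l), j)) = 0"
      using carr by (intro sum.neutral) (auto simp: E_def)
    also have "E n $$ (0, 0) = a n" using carr by (auto simp: E_def E2_def)
    also have "E n $$ (0, 1) = b n" using carr by (auto simp: E_def E2_def)
    finally have EF: "(E n * F n) $$ (0, j) = a n * F n $$ (0, j) + b n * F n $$ (1, j)" by simp
    show ?thesis
    proof (cases j)
      case 0
      then show ?thesis using EF eq[of n] carr by (simp add: F_def)
    next
      case (Suc j')
      then show ?thesis using EF eq[of n] carr c(2)[of j' n] j by (simp add: F_def)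
    qed
  qed
  with qp_unimodular_mult[OF E F] QP(1) show ?case by blast
qed

subsection \<open>Equivalence of matrix families\<close>

definition qp_equiv :: "nat \<Rightarrow> nat \<Rightarrow> (int \<Rightarrow> int mat) \<Rightarrow> (int \<Rightarrow> int mat) \<Rightarrow> bool" where
  "qp_equiv k s A B \<longleftrightarrow> qp_mat k s A \<and> (\<exists>U V. qp_unimodular k U \<and> qp_unimodular s V \<and>
     (\<forall>n. B n = U n * A n * V n))"

lemma qp_equivI:
  assumes "qp_mat k s A" "qp_unimodular k U" "qp_unimodular s V" "\<And>n. B n = U n * A n * V n"
  shows "qp_equiv k s A B"
  using assms unfolding qp_equiv_def by blast

lemma qp_equiv_refl: "qp_mat k s A \<Longrightarrow> qp_equiv k s A A"
  using qp_matD[of k s A]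
  by (intro qp_equivI[OF _ qp_unimodular_one qp_unimodular_one])
     (auto simp: left_mult_one_mat[of _ k s] right_mult_one_mat[of _ k s])

lemma qp_equiv_trans:
  assumes "qp_equiv k s A B" "qp_equiv k s B C"
  shows "qp_equiv k s A C"
proof -
  obtain U V where UV: "qp_unimodular k U" "qp_unimodular s V" "\<And>n. B n = U n * A n * V n"
    and A: "qp_mat k s A"
    using assms(1) by (auto simp: qp_equiv_def)
  obtain U' V' where UV': "qp_unimodular k U'" "qp_unimodular s V'" "\<And>n. C n = U' n * B n * V' n"
    using assms(2) by (auto simp: qp_equiv_def)
  have "C n = (U' n * U n) * A n * (V n * V' n)" for n
  proof -
    have carr: "U n \<in> carrier_mat k k" "U' n \<in> carrier_mat k k" "V n \<in> carrier_mat s s"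
      "V' n \<in> carrier_mat s s" "A n \<in> carrier_mat k s"
      using A UV UV' by (auto simp: qp_unimodular_def qp_matD)
    have "U' n * (U n * A n * V n) = U' n * (U n * A n) * V n"
      using carr by (intro assoc_mult_mat[symmetric, of _ k k _ s _ s]) auto
    also have "U' n * (U n * A n) = U' n * U n * A n"
      using carr by (intro assoc_mult_mat[symmetric, of _ k k _ k _ s]) auto
    finally show ?thesis
      unfolding UV'(3) UV(3) using carr by (simp only:) (intro assoc_mult_mat[of _ k s _ s _ s]; auto)
  qed
  then show ?thesis
    by (rule qp_equivI[OF A qp_unimodular_mult[OF UV'(1) UV(1)] qp_unimodular_mult[OF UV(2) UV'(2)]])
qed

lemma qp_equiv_mat: "qp_equiv k s A B \<Longrightarrow> qp_mat k s B"
proof -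
  assume "qp_equiv k s A B"
  then obtain U V where UV: "qp_mat k k U" "qp_mat s s V" "\<And>n. B n = U n * A n * V n" "qp_mat k s A"
    by (auto simp: qp_equiv_def qp_unimodular_def)
  have "qp_mat k s (\<lambda>n. U n * A n * V n)"
    using UV by (intro qp_mat_mult)
  also have "(\<lambda>n. U n * A n * V n) = B" using UV(3) by auto
  finally show ?thesis .
qed

section \<open>Creating a pivot and clearing its row and column\<close>

lemma dvd_mult_mat_entries:
  fixes A :: "int mat"
  assumes "U \<in> carrier_mat k k" "A \<in> carrier_mat k s" "V \<in> carrier_mat s s"
    and "\<And>i j. i < k \<Longrightarrow> j < s \<Longrightarrow> d dvd A $$ (i, j)" and "i < k" "j < s"
  shows "d dvd (U * A * V) $$ (i, j)"
proof -
  have "d dvd (U * A) $$ (i, l)" if "l < s" for l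
    using assms that by (subst index_mult_mat_sum[of _ k k _ s]) (auto intro!: dvd_sum)
  then show ?thesis
    using assms by (subst index_mult_mat_sum[of _ k s _ s]) (auto intro!: dvd_sum)
qed

text \<open>A row gcd dividing all entries is a value of the form at \<open>(x, y)\<close>. Since
  \<open>x\<close> and \<open>y\<close> are multiples of the first rows of \<open>U\<close> and
  \<open>W\<close>, this value is a multiple of the corner entry of U A W^T, which therefore divides
  all entries of \<open>A\<close> and of the product.\<close>

lemma qp_equiv_pivot:
  assumes A: "qp_mat (Suc k) (Suc s) A"
  shows "\<exists>B. qp_equiv (Suc k) (Suc s) A B \<and>
    (\<forall>n. \<forall>i<Suc k. \<forall>j<Suc s. B n $$ (0, 0) dvd B n $$ (i, j))"
proof -
  let ?k = "Suc k" and ?s = "Suc s"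
  \<comment> \<open>Padding by 0 is needed because the lemmas on row gcds ask for quasi-polynomials
    at all index pairs.\<close>
  define a where "a n i j = (if i < ?k \<and> j < ?s then A n $$ (i, j) else 0)" for n i j
  have a: "(\<lambda>n. a n i j) \<in> QP" for i j
    using A by (cases "i < ?k \<and> j < ?s") (auto simp: a_def qp_mat_entry)
  obtain x where x: "QP_vec x"
    "\<And>n i j. i < ?k \<Longrightarrow> j < ?s \<Longrightarrow> row_gcd ?k ?s (a n) (x n) dvd a n i j"
    using row_gcd_dvd_all[of a ?k ?s, OF a] by blast
  obtain y where y: "QP_vec y" "\<And>n. row_gcd ?k ?s (a n) (x n) = bilin ?k ?s (a n) (x n) (y n)"
    using QP_row_gcd_eq_bilin[of a x ?k ?s, OF a x(1)] by blast
  obtain U c where U: "qp_unimodular ?k U" "\<And>n i. i < ?k \<Longrightarrow> x n i = c n * U n $$ (0, i)"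
    using unimodular_completion[OF x(1), of k] by blast
  obtain W e where W: "qp_unimodular ?s W" "\<And>n j. j < ?s \<Longrightarrow> y n j = e n * W n $$ (0, j)"
    using unimodular_completion[OF y(1), of s] by blast
  define V where "V n = transpose_mat (W n)" for n
  have V: "qp_unimodular ?s V" unfolding V_def using W(1) by (rule qp_unimodular_transpose)
  define B where "B n = U n * A n * V n" for n
  have "B n $$ (0, 0) dvd B n $$ (i, j)" if ij: "i < ?k" "j < ?s" for n i j
  proof -
    have carr: "U n \<in> carrier_mat ?k ?k" "A n \<in> carrier_mat ?k ?s" "V n \<in> carrier_mat ?s ?s"
      "W n \<in> carrier_mat ?s ?s"
      using U(1) W(1) V A by (auto simp: qp_unimodular_def qp_matD)
    have "B n $$ (0, 0) = (\<Sum>j<?s. (U n * A n) $$ (0, j) * V n $$ (j, 0))"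
      unfolding B_def using carr by (intro index_mult_mat_sum[of _ ?k]) auto
    also have "\<dots> = (\<Sum>j<?s. (\<Sum>i<?k. U n $$ (0, i) * a n i j) * W n $$ (0, j))"
    proof (intro sum.cong refl)
      fix j assume "j \<in> {..<?s}"
      then have j: "j < ?s" by simp
      have "(U n * A n) $$ (0, j) = (\<Sum>i<?k. U n $$ (0, i) * A n $$ (i, j))"
        using carr j by (intro index_mult_mat_sum) auto
      also have "\<dots> = (\<Sum>i<?k. U n $$ (0, i) * a n i j)"
        using j by (intro sum.cong) (auto simp: a_def)
      finally show "(U n * A n) $$ (0, j) * V n $$ (j, 0) = (\<Sum>i<?k. U n $$ (0, i) * a n i j) * W n $$ (0, j)"
        using carr j by (simp add: V_def)
    qed
    finally have B00: "B n $$ (0, 0) = (\<Sum>j<?s. (\<Sum>i<?k. U n $$ (0, i) * a n i j) * W n $$ (0, j))" .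
    have "row_gcd ?k ?s (a n) (x n) = (\<Sum>j<?s. (\<Sum>i<?k. (c n * U n $$ (0, i)) * a n i j) * (e n * W n $$ (0, j)))"
      unfolding y(2) bilin_eq_sum_columns using U(2) W(2) by (intro sum.cong arg_cong2[of _ _ _ _ "(*)"]) auto
    also have "\<dots> = (c n * e n) * B n $$ (0, 0)"
      unfolding B00 sum_distrib_left sum_distrib_right
      by (intro sum.cong refl) (simp only: mult_ac)
    finally have "B n $$ (0, 0) dvd row_gcd ?k ?s (a n) (x n)" by simp
    then have "B n $$ (0, 0) dvd A n $$ (i, j)" if "i < ?k" "j < ?s" for i j
      using x(2)[OF that, of n] that by (auto simp: a_def intro: dvd_trans)
    then show ?thesis
      unfolding B_def using carr ij by (intro dvd_mult_mat_entries[of _ ?k _ ?s]) auto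
  qed
  moreover have "qp_equiv ?k ?s A B"
    using A U(1) V by (rule qp_equivI) (simp add: B_def)
  ultimately show ?thesis by blast
qed

definition border_mat :: "nat \<Rightarrow> nat \<Rightarrow> int \<Rightarrow> int mat \<Rightarrow> int mat" where
  "border_mat k s d B = four_block_mat (mat 1 1 (\<lambda>_. d)) (0\<^sub>m 1 s) (0\<^sub>m k 1) B"

text \<open>The quotients by the pivot are quasi-polynomials by \<open>QP_exact_div\<close>. The
  matrix \<open>L\<close> clears the first column and makes the pivot nonnegative; \<open>R\<close>
  clears the first row.\<close>

lemma qp_equiv_clear:
  assumes A: "qp_mat (Suc k) (Suc s) A"
    and piv: "\<And>n i j. i < Suc k \<Longrightarrow> j < Suc s \<Longrightarrow> A n $$ (0, 0) dvd A n $$ (i, j)"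
  shows "\<exists>d B. qp_mat k s B \<and> qp_equiv (Suc k) (Suc s) A (\<lambda>n. border_mat k s (d n) (B n)) \<and>
    (\<forall>n. d n \<ge> 0 \<and> (\<forall>i<k. \<forall>j<s. d n dvd B n $$ (i, j)))"
proof -
  define c where "c n = A n $$ (0, 0)" for n
  have c: "c \<in> QP" unfolding c_def using A by (intro qp_mat_entry) auto
  have quot: "\<exists>q\<in>QP. \<forall>n. A n $$ (i, j) = q n * c n" if "i < Suc k" "j < Suc s" for i j
    using QP_exact_div[OF c qp_mat_entry[OF A that]] piv[OF that] unfolding c_def .
  have "\<forall>i. \<exists>q. i < k \<longrightarrow> q \<in> QP \<and> (\<forall>n. A n $$ (Suc i, 0) = q n * c n)"
    using quot[of "Suc _" 0] by auto
  from choice[OF this] obtain p where p: "\<And>i. i < k \<Longrightarrow> p i \<in> QP" "\<And>i n. i < k \<Longrightarrow> A n $$ (Suc i, 0) = p i n * c n"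
    by blast
  have "\<forall>j. \<exists>q. j < s \<longrightarrow> q \<in> QP \<and> (\<forall>n. A n $$ (0, Suc j) = q n * c n)"
    using quot[of 0 "Suc _"] by auto
  from choice[OF this] obtain q where q: "\<And>j. j < s \<Longrightarrow> q j \<in> QP" "\<And>j n. j < s \<Longrightarrow> A n $$ (0, Suc j) = q j n * c n"
    by blast
  \<comment> \<open>At \<open>c n = 0\<close> the value is -1 rather than 0, so
    \<open>det (L n)\<close> is a unit there as well.\<close>
  define \<sigma> where "\<sigma> n = (if c n > 0 then 1 else -1 :: int)" for n
  have \<sigma>: "\<sigma> \<in> QP" unfolding \<sigma>_def using c by (intro QP_if_pos) auto
  let ?m = "\<lambda>x :: int. mat 1 1 (\<lambda>_ :: nat \<times> nat. x)"
  define P where "P n = mat k 1 (\<lambda>(i, _). - p i n)" for n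
  define Q where "Q n = mat 1 s (\<lambda>(_, j). - q j n)" for n
  define L where "L n = four_block_mat (?m (\<sigma> n)) (0\<^sub>m 1 k) (P n) (1\<^sub>m k)" for n
  define R where "R n = four_block_mat (1\<^sub>m 1) (Q n) (0\<^sub>m s 1) (1\<^sub>m s)" for n
  define A2 where "A2 n = mat 1 s (\<lambda>(_, j). q j n * c n)" for n
  define A3 where "A3 n = mat k 1 (\<lambda>(i, _). p i n * c n)" for n
  define A4 where "A4 n = mat k s (\<lambda>(i, j). A n $$ (Suc i, Suc j))" for n
  define B where "B n = mat k s (\<lambda>(i, j). A n $$ (Suc i, Suc j) - p i n * q j n * c n)" for n
  have "qp_mat 1 1 (\<lambda>n. ?m (\<sigma> n))"
    using qp_matI[of 1 1 "\<lambda>n _ _. \<sigma> n"] \<sigma> by (simp add: case_prod_unfold)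
  moreover have "qp_mat k 1 P"
    unfolding P_def using qp_matI[of k 1 "\<lambda>n i _. - p i n"] p(1) by (simp add: case_prod_unfold)
  ultimately have "qp_mat (1 + k) (1 + k) L"
    unfolding L_def by (intro qp_mat_four_block qp_mat_const) auto
  moreover have "det (L n) = \<sigma> n" for n
    unfolding L_def by (subst det_four_block_mat_upper_right_zero[of _ 1 _ k]) (auto simp: P_def det_single)
  ultimately have L: "qp_unimodular (Suc k) L"
    by (auto simp: qp_unimodular_def \<sigma>_def)
  have "qp_mat 1 s Q"
    unfolding Q_def using qp_matI[of 1 s "\<lambda>n _ j. - q j n"] q(1) by (simp add: case_prod_unfold)
  then have "qp_mat (1 + s) (1 + s) R"
    unfolding R_def by (intro qp_mat_four_block qp_mat_const) auto
  moreover have "det (R n) = 1" for n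
    unfolding R_def by (subst det_four_block_mat_lower_left_zero[of _ 1 _ s]) (auto simp: Q_def)
  ultimately have R: "qp_unimodular (Suc s) R"
    by (auto simp: qp_unimodular_def)
  have B: "qp_mat k s B"
    unfolding B_def using p(1) q(1) c A
    by (intro qp_matI QP_diff QP_mult qp_mat_entry) auto
  have "border_mat k s \<bar>c n\<bar> (B n) = L n * A n * R n" for n
  proof -
    have An: "A n = four_block_mat (?m (c n)) (A2 n) (A3 n) (A4 n)"
    proof (rule eq_matI)
      fix i j
      assume "i < dim_row (four_block_mat (?m (c n)) (A2 n) (A3 n) (A4 n))"
        "j < dim_col (four_block_mat (?m (c n)) (A2 n) (A3 n) (A4 n))"
      then have "i < Suc k" "j < Suc s" by (auto simp: A4_def)
      then show "A n $$ (i, j) = four_block_mat (?m (c n)) (A2 n) (A3 n) (A4 n) $$ (i, j)"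
        using p(2)[of "i - 1" n] q(2)[of "j - 1" n]
        by (cases i; cases j) (auto simp: A2_def A3_def A4_def c_def)
    qed (use qp_matD[OF A, of n] in \<open>auto simp: A4_def\<close>)
    have "L n * A n = four_block_mat (?m \<bar>c n\<bar>) (\<sigma> n \<cdot>\<^sub>m A2 n) (0\<^sub>m k 1) (B n)"
      unfolding L_def An
      by (subst mult_four_block_mat[of _ 1 1 _ k _ k _ _ 1 _ s];
          (intro cong_four_block_mat eq_matI)?)
         (auto simp: P_def A2_def A3_def A4_def B_def \<sigma>_def scalar_prod_def)
    also have "\<dots> * R n = border_mat k s \<bar>c n\<bar> (B n)"
      unfolding R_def border_mat_def
      by (subst mult_four_block_mat[of _ 1 1 _ s _ k _ _ 1 _ s];
          (intro cong_four_block_mat eq_matI)?)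
         (auto simp: Q_def A2_def B_def \<sigma>_def scalar_prod_def)
    finally show ?thesis by simp
  qed
  then have "qp_equiv (Suc k) (Suc s) A (\<lambda>n. border_mat k s \<bar>c n\<bar> (B n))"
    by (rule qp_equivI[OF A L R])
  moreover have "\<bar>c n\<bar> dvd B n $$ (i, j)" if "i < k" "j < s" for n i j
    using that piv[of "Suc i" "Suc j" n] by (simp add: B_def c_def)
  ultimately show ?thesis using B by (intro exI[of _ "\<lambda>n. \<bar>c n\<bar>"] exI[of _ B]) auto
qed

text \<open>Zeros are allowed on the diagonal; divisibility forces them to the end. This form suits
  recursion on the size better than \<open>smith_shape\<close> with its explicit rank.\<close>

definition diag_chain :: "nat \<Rightarrow> nat \<Rightarrow> int mat \<Rightarrow> bool" where
  "diag_chain k s D \<longleftrightarrow> (\<forall>i<k. \<forall>j<s. i \<noteq> j \<longrightarrow> D $$ (i, j) = 0) \<and>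
     (\<forall>i<min k s. D $$ (i, i) \<ge> 0) \<and>
     (\<forall>i. Suc i < min k s \<longrightarrow> D $$ (i, i) dvd D $$ (Suc i, Suc i))"

lemma diag_chain_border:
  assumes "D \<in> carrier_mat k s" "diag_chain k s D" "d \<ge> 0"
    and "\<And>i j. i < k \<Longrightarrow> j < s \<Longrightarrow> d dvd D $$ (i, j)"
  shows "diag_chain (Suc k) (Suc s) (border_mat k s d D)"
proof -
  have idx: "border_mat k s d D $$ (i, j) =
     (if i = 0 then if j = 0 then d else 0 else if j = 0 then 0 else D $$ (i - 1, j - 1))"
    if "i < Suc k" "j < Suc s" for i j
    using that assms(1) by (auto simp: border_mat_def)
  have "border_mat k s d D $$ (i, i) dvd border_mat k s d D $$ (Suc i, Suc i)"
    if "Suc i < min (Suc k) (Suc s)" for i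
    using that assms(2,4) by (cases i) (auto simp: idx diag_chain_def)
  moreover have "border_mat k s d D $$ (i, i) \<ge> 0" if "i < min (Suc k) (Suc s)" for i
    using that assms(2,3) by (cases i) (auto simp: idx diag_chain_def)
  moreover have "border_mat k s d D $$ (i, j) = 0" if "i < Suc k" "j < Suc s" "i \<noteq> j" for i j
    using that assms(2) by (cases i; cases j) (auto simp: idx diag_chain_def)
  ultimately show ?thesis unfolding diag_chain_def by blast
qed

lemma qp_equiv_border:
  assumes "qp_equiv k s A B" "d \<in> QP"
  shows "qp_equiv (Suc k) (Suc s) (\<lambda>n. border_mat k s (d n) (A n)) (\<lambda>n. border_mat k s (d n) (B n))"
proof -
  obtain U V where UV: "qp_unimodular k U" "qp_unimodular s V" "\<And>n. B n = U n * A n * V n"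
    and A: "qp_mat k s A"
    using assms(1) by (auto simp: qp_equiv_def)
  let ?U = "\<lambda>n. four_block_mat (1\<^sub>m 1) (0\<^sub>m 1 k) (0\<^sub>m k 1) (U n)"
  let ?V = "\<lambda>n. four_block_mat (1\<^sub>m 1) (0\<^sub>m 1 s) (0\<^sub>m s 1) (V n)"
  have "qp_mat 1 1 (\<lambda>n. mat 1 1 (\<lambda>_. d n))"
    using qp_matI[of 1 1 "\<lambda>n _ _. d n"] assms(2) by (simp add: case_prod_unfold)
  then have "qp_mat (1 + k) (1 + s) (\<lambda>n. border_mat k s (d n) (A n))"
    unfolding border_mat_def using A by (intro qp_mat_four_block qp_mat_const) auto
  moreover have "qp_unimodular (1 + k) ?U" "qp_unimodular (1 + s) ?V"
    using UV by (intro qp_unimodular_block_diag qp_unimodular_one; simp)+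
  moreover have "border_mat k s (d n) (B n) = ?U n * border_mat k s (d n) (A n) * ?V n" for n
  proof -
    have carr: "U n \<in> carrier_mat k k" "V n \<in> carrier_mat s s" "A n \<in> carrier_mat k s"
      "U n * A n \<in> carrier_mat k s"
      using A UV by (auto simp: qp_unimodular_def qp_matD intro!: mult_carrier_mat[of _ k k])
    have "?U n * border_mat k s (d n) (A n) = border_mat k s (d n) (U n * A n)"
      unfolding border_mat_def using carr
      by (subst mult_four_block_mat[of _ 1 1 _ k _ k _ _ 1 _ s]) (auto simp: left_mult_one_mat[of _ 1 1])
    moreover have "border_mat k s (d n) (U n * A n) * ?V n = border_mat k s (d n) (B n)"
      unfolding border_mat_def UV(3) using carr
      by (subst mult_four_block_mat[of _ 1 1 _ s _ k _ _ 1 _ s]) (auto simp: right_mult_one_mat[of _ 1 1])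
    ultimately show ?thesis by simp
  qed
  ultimately show ?thesis by (intro qp_equivI) auto
qed

lemma qp_equiv_diag_chain:
  assumes "qp_mat k s A"
  shows "\<exists>D. qp_equiv k s A D \<and> (\<forall>n. diag_chain k s (D n))"
  using assms
proof (induction k arbitrary: s A)
  case 0
  then show ?case using qp_equiv_refl by (intro exI[of _ A]) (auto simp: diag_chain_def)
next
  case (Suc k)
  show ?case
  proof (cases s)
    case 0
    then show ?thesis using Suc.prems qp_equiv_refl by (intro exI[of _ A]) (auto simp: diag_chain_def)
  next
    case s: (Suc s')
    obtain A' where A': "qp_equiv (Suc k) (Suc s') A A'"
      "\<And>n i j. i < Suc k \<Longrightarrow> j < Suc s' \<Longrightarrow> A' n $$ (0, 0) dvd A' n $$ (i, j)"
      using qp_equiv_pivot[of k s' A] Suc.prems s by blast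
    obtain d B where B: "qp_mat k s' B" "qp_equiv (Suc k) (Suc s') A' (\<lambda>n. border_mat k s' (d n) (B n))"
      and d: "\<And>n. d n \<ge> 0" "\<And>n i j. i < k \<Longrightarrow> j < s' \<Longrightarrow> d n dvd B n $$ (i, j)"
      using qp_equiv_clear[OF qp_equiv_mat[OF A'(1)] A'(2)] by blast
    have "(\<lambda>n. border_mat k s' (d n) (B n) $$ (0, 0)) \<in> QP"
      using qp_equiv_mat[OF B(2)] by (intro qp_mat_entry) auto
    then have dQP: "d \<in> QP" by (simp add: border_mat_def)
    obtain D where D: "qp_equiv k s' B D" "\<And>n. diag_chain k s' (D n)"
      using Suc.IH[OF B(1)] by blast
    obtain U V where UV: "qp_unimodular k U" "qp_unimodular s' V" "\<And>n. D n = U n * B n * V n"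
      using D(1) by (auto simp: qp_equiv_def)
    \<comment> \<open>The pivot divides every entry of the block \<open>B n\<close>, and this
      survives multiplication by \<open>U n\<close> and \<open>V n\<close>; so the pivot continues
      the divisibility chain of the block.\<close>
    have "d n dvd D n $$ (i, j)" if "i < k" "j < s'" for n i j
      unfolding UV(3) using UV(1,2) B(1) d(2) that
      by (intro dvd_mult_mat_entries[of _ k _ s']) (auto simp: qp_unimodular_def qp_matD)
    then have "diag_chain (Suc k) s (border_mat k s' (d n) (D n))" for n
      unfolding s using D(2) d(1) qp_matD[OF qp_equiv_mat[OF D(1)]] by (intro diag_chain_border) auto
    moreover have "qp_equiv (Suc k) s A (\<lambda>n. border_mat k s' (d n) (D n))"
      unfolding s using A'(1) B(2) qp_equiv_border[OF D(1) dQP] by (blast intro: qp_equiv_trans)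
    ultimately show ?thesis by (intro exI[of _ "\<lambda>n. border_mat k s' (d n) (D n)"]) simp
  qed
qed

subsection \<open>Uniqueness of the Smith normal form\<close>

text \<open>Every term of the Leibniz formula meets the block: a permutation cannot map the
  \<open>n - m\<close> rows from \<open>m\<close> on into the \<open>n - m - 1\<close> columns
  beyond \<open>m\<close>.\<close>

lemma dvd_det_if_dvd_block:
  fixes A :: "'a :: comm_ring_1 mat"
  assumes A: "A \<in> carrier_mat n n" and m: "m < n"
    and dvd: "\<And>i j. m \<le> i \<Longrightarrow> i < n \<Longrightarrow> j \<le> m \<Longrightarrow> p dvd A $$ (i, j)"
  shows "p dvd det A"
  unfolding det_def'[OF A]
proof (rule dvd_sum)
  fix \<pi> assume "\<pi> \<in> {\<pi>. \<pi> permutes {0..<n}}"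
  then have \<pi>: "\<pi> permutes {0..<n}" by simp
  have "\<exists>i. m \<le> i \<and> i < n \<and> \<pi> i \<le> m"
  proof (rule ccontr)
    assume "\<not> ?thesis"
    then have "\<pi> ` {m..<n} \<subseteq> {Suc m..<n}"
      using permutes_in_image[OF \<pi>] by fastforce
    then have "card {m..<n} \<le> card {Suc m..<n}"
      using permutes_inj_on[OF \<pi>] by (intro card_inj_on_le) auto
    with m show False by simp
  qed
  then obtain i where i: "m \<le> i" "i < n" "\<pi> i \<le> m" by blast
  then have "p dvd A $$ (i, \<pi> i)" by (intro dvd)
  also have "A $$ (i, \<pi> i) dvd (\<Prod>i = 0..<n. A $$ (i, \<pi> i))"
    using i by (intro dvd_prodI) auto
  finally show "p dvd signof \<pi> * (\<Prod>i = 0..<n. A $$ (i, \<pi> i))" by (rule dvd_mult)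
qed

lemma int_dvd_if_prime_powers_dvd:
  fixes a b :: int
  assumes pp: "\<And>p e. prime p \<Longrightarrow> p ^ e dvd a \<Longrightarrow> p ^ e dvd b"
  shows "a dvd b"
proof (cases "a = 0 \<or> b = 0")
  case True
  have "b = 0" if "a = 0"
  proof (rule ccontr)
    assume "b \<noteq> 0"
    \<comment> \<open>All powers of 2 divide \<open>a = 0\<close>, hence \<open>b\<close>; this one
      is too large to divide a nonzero \<open>b\<close>.\<close>
    have "(2 :: int) ^ nat \<bar>b\<bar> dvd b" using pp[of 2 "nat \<bar>b\<bar>"] that by simp
    then have "(2 :: int) ^ nat \<bar>b\<bar> \<le> \<bar>b\<bar>" using \<open>b \<noteq> 0\<close> by (intro zdvd_imp_le) auto
    moreover have "int (nat \<bar>b\<bar>) < int (2 ^ nat \<bar>b\<bar>)" by (subst of_nat_less_iff) (rule less_exp)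
    ultimately show False by simp
  qed
  with True show ?thesis by auto
next
  case False
  show ?thesis
  proof (rule multiplicity_le_imp_dvd)
    fix p :: int assume p: "prime p"
    have "p ^ multiplicity p a dvd b" by (rule pp[OF p multiplicity_dvd])
    then show "multiplicity p a \<le> multiplicity p b"
      using False p by (intro multiplicity_geI) auto
  qed (use False in auto)
qed

lemma smith_shape_diag:
  assumes "smith_shape D" "D \<in> carrier_mat k s"
  shows "\<exists>d. (\<forall>i. d i \<ge> 0) \<and> (\<forall>i j. i \<le> j \<longrightarrow> d i dvd d j) \<and>
    D = mat k s (\<lambda>(i, j). if i = j then d i else 0)"
proof -
  obtain r d where rd: "\<And>i. i < r \<Longrightarrow> d i > 0" "\<And>i. Suc i < r \<Longrightarrow> d i dvd d (Suc i)"
    "D = mat (dim_row D) (dim_col D) (\<lambda>(i, j). if i = j \<and> i < r then d i else 0)"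
    using assms(1) unfolding smith_shape_def by blast
  \<comment> \<open>Extended by 0 beyond the rank, the chain runs over all of \<open>nat\<close>,
    since everything divides 0.\<close>
  define e where "e i = (if i < r then d i else 0 :: int)" for i
  have step: "e i dvd e (Suc i)" for i using rd(2) by (auto simp: e_def)
  have "e i dvd e j" if "i \<le> j" for i j
    using that by (induction rule: dec_induct) (auto intro: dvd_trans step)
  moreover have "e i \<ge> 0" for i using rd(1)[of i] by (cases "i < r") (auto simp: e_def)
  moreover have "D = mat k s (\<lambda>(i, j). if i = j then e i else 0)"
    using assms(2) rd(3) by (simp add: e_def carrier_matD cong: if_cong) (smt (verit) cong_mat prod.case)
  ultimately show ?thesis by blast
qed

text \<open>Suppose \<open>p ^ e\<close> divides \<open>d' m\<close> but not \<open>d m\<close>. For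
  \<open>i \<ge> m\<close> and \<open>j \<le> m\<close> the entry \<open>P $$ (i, j) * d j\<close>
  of the product is a multiple of \<open>d' i\<close>, hence of \<open>p ^ e\<close>, while
  \<open>d j\<close> divides \<open>d m\<close> and so is not. Hence \<open>p\<close> divides
  \<open>P $$ (i, j)\<close>, and with the whole block also \<open>det P\<close>.\<close>

lemma diag_dvd_if_equiv:
  fixes d d' :: "nat \<Rightarrow> int" and k s :: nat
  defines "D \<equiv> mat k s (\<lambda>(i, j). if i = j then d i else 0)"
    and "D' \<equiv> mat k s (\<lambda>(i, j). if i = j then d' i else 0)"
  assumes P: "P \<in> carrier_mat k k" "det P = 1 \<or> det P = -1" and W: "W \<in> carrier_mat s s"
    and eq: "P * D = D' * W"
    and d: "\<And>i j. i \<le> j \<Longrightarrow> d i dvd d j" and d': "\<And>i j. i \<le> j \<Longrightarrow> d' i dvd d' j"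
    and m: "m < k" "m < s"
  shows "d' m dvd d m"
proof (rule int_dvd_if_prime_powers_dvd, rule ccontr)
  fix p e assume p: "prime (p :: int)" and q: "p ^ e dvd d' m" "\<not> p ^ e dvd d m"
  have "p dvd P $$ (i, j)" if ij: "m \<le> i" "i < k" "j \<le> m" for i j
  proof (rule ccontr)
    assume "\<not> p dvd P $$ (i, j)"
    then have cop: "coprime (p ^ e) (P $$ (i, j))"
      using p by (simp add: prime_imp_coprime)
    have js: "j < s" using ij m by simp
    have "(P * D) $$ (i, j) = (\<Sum>l\<in>{0..<k}. P $$ (i, l) * D $$ (l, j))"
      using P ij js by (auto simp: scalar_prod_def D_def intro!: sum.cong)
    also have "\<dots> = (\<Sum>l\<in>{0..<k}. if l = j then P $$ (i, j) * d j else 0)"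
      using js by (intro sum.cong) (auto simp: D_def)
    also have "\<dots> = P $$ (i, j) * d j" using ij by simp
    finally have PD: "(P * D) $$ (i, j) = P $$ (i, j) * d j" .
    have "(D' * W) $$ (i, j) = (\<Sum>l\<in>{0..<s}. D' $$ (i, l) * W $$ (l, j))"
      using W ij js by (auto simp: scalar_prod_def D'_def intro!: sum.cong)
    also have "p ^ e dvd \<dots>"
      using ij q(1) d'[OF ij(1)] by (intro dvd_sum) (auto simp: D'_def intro: dvd_trans)
    finally have "p ^ e dvd P $$ (i, j) * d j" using PD eq by simp
    then have "p ^ e dvd d j" using cop by (simp add: coprime_dvd_mult_right_iff)
    then show False using q(2) d[OF ij(3)] dvd_trans by blast
  qed
  then have "p dvd det P" using P m by (intro dvd_det_if_dvd_block[of P k m])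
  then have "p dvd 1" using P(2) by auto
  then show False using p not_prime_unit by blast
qed

lemma unimodular_inverse:
  assumes U: "U \<in> carrier_mat n n" and "unimodular U"
  obtains U' where "U' \<in> carrier_mat n n" "unimodular U'" "U * U' = 1\<^sub>m n" "U' * U = 1\<^sub>m n"
proof
  \<comment> \<open>As \<open>det U\<close> is its own inverse, this is the inverse of
    \<open>U\<close> given by the adjugate.\<close>
  let ?U' = "det U \<cdot>\<^sub>m adj_mat U"
  have sq: "det U * det U = 1" using assms(2) by (auto simp: unimodular_def)
  show carr: "?U' \<in> carrier_mat n n" using adj_mat(1)[OF U] by simp
  have "U * ?U' = det U \<cdot>\<^sub>m (U * adj_mat U)"
    using U adj_mat(1)[OF U] by (intro mult_smult_distrib)
  also have "\<dots> = (det U * det U) \<cdot>\<^sub>m 1\<^sub>m n"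
    unfolding adj_mat(2)[OF U] by (intro eq_matI) auto
  finally show UU': "U * ?U' = 1\<^sub>m n" unfolding sq by (auto intro!: eq_matI)
  have "?U' * U = det U \<cdot>\<^sub>m (adj_mat U * U)"
    using U adj_mat(1)[OF U] by (intro mult_smult_assoc_mat)
  also have "\<dots> = (det U * det U) \<cdot>\<^sub>m 1\<^sub>m n"
    unfolding adj_mat(3)[OF U] by (intro eq_matI) auto
  finally show "?U' * U = 1\<^sub>m n" unfolding sq by (auto intro!: eq_matI)
  have "det U * det ?U' = 1" using det_mult[OF U carr] UU' by simp
  then have "det ?U' = 1 \<or> det ?U' = -1" using zmult_eq_1_iff by blast
  with carr show "unimodular ?U'" unfolding unimodular_def by (metis carrier_matD square_mat.simps)
qed

text \<open>With \<open>X\<close> and \<open>Y\<close> the inverses of \<open>U\<close> and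
  \<open>V'\<close>, both (U' X) D and D' (Y V) equal U' M V, so the preceding lemma applies with
  \<open>P = U' * X\<close> and \<open>W = Y * V\<close>.\<close>

lemma smith_normal_form_diag_dvd:
  assumes M: "M \<in> carrier_mat k s"
    and U: "U \<in> carrier_mat k k" "unimodular U" and V: "V \<in> carrier_mat s s" "unimodular V"
    and U': "U' \<in> carrier_mat k k" "unimodular U'" and V': "V' \<in> carrier_mat s s" "unimodular V'"
    and D: "U * M * V = mat k s (\<lambda>(i, j). if i = j then d i else 0)"
    and D': "U' * M * V' = mat k s (\<lambda>(i, j). if i = j then d' i else 0)"
    and d: "\<And>i j. i \<le> j \<Longrightarrow> d i dvd d j" and d': "\<And>i j. i \<le> j \<Longrightarrow> d' i dvd d' j"
    and m: "m < k" "m < s"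
  shows "d' m dvd d m"
proof -
  obtain X where X: "X \<in> carrier_mat k k" "unimodular X" "X * U = 1\<^sub>m k"
    using unimodular_inverse[OF U] by blast
  obtain Y where Y: "Y \<in> carrier_mat s s" "V' * Y = 1\<^sub>m s"
    using unimodular_inverse[OF V'] by blast
  have MV: "M * V \<in> carrier_mat k s" using M V by (intro mult_carrier_mat)
  have UM: "U' * M \<in> carrier_mat k s" using M U' by (intro mult_carrier_mat)
  have YV: "Y * V \<in> carrier_mat s s" using Y V by (intro mult_carrier_mat)
  have "V' * (Y * V) = V' * Y * V"
    using V' Y V by (intro assoc_mult_mat[symmetric, of _ s s _ s _ s]) auto
  also have "\<dots> = V" unfolding Y(2) using V(1) by (rule left_mult_one_mat)
  finally have YV': "V' * (Y * V) = V" .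
  have "U' * X * (U * M * V) = U' * X * (U * (M * V))"
    using M U V by (simp add: assoc_mult_mat[of U k k M s V s])
  also have "\<dots> = U' * (X * (U * (M * V)))"
    using U' X U MV by (intro assoc_mult_mat[of _ k k _ k _ s]) auto
  also have "X * (U * (M * V)) = (X * U) * (M * V)"
    using X U MV by (intro assoc_mult_mat[symmetric, of _ k k _ k _ s]) auto
  also have "\<dots> = M * V" unfolding X(3) using MV by (rule left_mult_one_mat)
  also have "U' * (M * V) = U' * M * V"
    using M U' V by (intro assoc_mult_mat[symmetric, of _ k k _ s _ s]) auto
  also have "\<dots> = U' * M * (V' * (Y * V))" unfolding YV' ..
  also have "U' * M * (V' * (Y * V)) = U' * M * V' * (Y * V)"
    using UM V' YV by (intro assoc_mult_mat[symmetric, of _ k s _ s _ s]) auto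
  finally have "U' * X * (U * M * V) = U' * M * V' * (Y * V)" .
  moreover have "det (U' * X) = 1 \<or> det (U' * X) = -1"
    using det_mult[OF U'(1) X(1)] U'(2) X(2) unfolding unimodular_def by auto
  ultimately show ?thesis
    using U' X YV d d' m unfolding D D'
    by (intro diag_dvd_if_equiv[of "U' * X" k "Y * V" s d d']) (auto intro!: mult_carrier_mat[of _ k k])
qed

lemma smith_normal_form_unique:
  assumes "is_smith_normal_form M D" "is_smith_normal_form M D'"
  shows "D = D'"
proof -
  define k s where "k = dim_row M" "s = dim_col M"
  have M: "M \<in> carrier_mat k s" by (auto simp: k_s_def)
  obtain U V where UV: "U \<in> carrier_mat k k" "unimodular U" "V \<in> carrier_mat s s" "unimodular V"
    "U * M * V = D" "smith_shape D" "D \<in> carrier_mat k s"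
    using assms(1) unfolding is_smith_normal_form_def k_s_def by blast
  obtain U' V' where UV': "U' \<in> carrier_mat k k" "unimodular U'" "V' \<in> carrier_mat s s" "unimodular V'"
    "U' * M * V' = D'" "smith_shape D'" "D' \<in> carrier_mat k s"
    using assms(2) unfolding is_smith_normal_form_def k_s_def by blast
  obtain d where d: "\<And>i. d i \<ge> 0" "\<And>i j. i \<le> j \<Longrightarrow> d i dvd d j"
    "D = mat k s (\<lambda>(i, j). if i = j then d i else 0)"
    using smith_shape_diag[OF UV(6,7)] by blast
  obtain d' where d': "\<And>i. d' i \<ge> 0" "\<And>i j. i \<le> j \<Longrightarrow> d' i dvd d' j"
    "D' = mat k s (\<lambda>(i, j). if i = j then d' i else 0)"
    using smith_shape_diag[OF UV'(6,7)] by blast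
  have "d m = d' m" if "m < k" "m < s" for m
    using smith_normal_form_diag_dvd[OF M UV(1-4) UV'(1-4) UV(5)[unfolded d(3)] UV'(5)[unfolded d'(3)] d(2) d'(2) that]
      smith_normal_form_diag_dvd[OF M UV'(1-4) UV(1-4) UV'(5)[unfolded d'(3)] UV(5)[unfolded d(3)] d'(2) d(2) that]
      d(1) d'(1) by (intro zdvd_antisym_nonneg) auto
  then show ?thesis unfolding d(3) d'(3) by (intro eq_matI) auto
qed

lemma smith_normal_form_eqI: "is_smith_normal_form M D \<Longrightarrow> smith_normal_form M = D"
  unfolding smith_normal_form_def using smith_normal_form_unique by blast

lemma diag_chain_smith_shape:
  assumes D: "D \<in> carrier_mat k s" and chain: "diag_chain k s D"
  shows "smith_shape D"
proof -
  \<comment> \<open>The position of the first zero on the diagonal, or \<open>min k s\<close> if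
    there is none; by divisibility all later diagonal entries vanish too.\<close>
  define r where "r = (LEAST r. r = min k s \<or> D $$ (r, r) = 0)"
  have r: "r = min k s \<or> D $$ (r, r) = 0"
    unfolding r_def by (rule LeastI[of _ "min k s"]) simp
  have r_le: "r \<le> min k s" unfolding r_def by (rule Least_le) simp
  have nonzero: "D $$ (i, i) \<noteq> 0" if "i < r" for i
    using not_less_Least[of i "\<lambda>r. r = min k s \<or> D $$ (r, r) = 0"] that by (simp add: r_def)
  have zero: "D $$ (i, i) = 0" if "r \<le> i" "i < min k s" for i
    using that
  proof (induction rule: dec_induct)
    case base
    then show ?case using r by auto
  next
    case (step i)
    then have "D $$ (i, i) dvd D $$ (Suc i, Suc i)" using chain by (auto simp: diag_chain_def)
    with step show ?case by simp
  qed
  have "D $$ (i, i) > 0" if "i < r" for i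
    using nonzero[OF that] chain that r_le by (auto simp: diag_chain_def order_less_le)
  moreover have "D = mat k s (\<lambda>(i, j). if i = j \<and> i < r then D $$ (i, i) else 0)"
  proof (rule eq_matI)
    fix i j
    assume "i < dim_row (mat k s (\<lambda>(i, j). if i = j \<and> i < r then D $$ (i, i) else 0))"
      "j < dim_col (mat k s (\<lambda>(i, j). if i = j \<and> i < r then D $$ (i, i) else 0))"
    then show "D $$ (i, j) = mat k s (\<lambda>(i, j). if i = j \<and> i < r then D $$ (i, i) else 0) $$ (i, j)"
      using chain zero[of i] by (cases "i = j") (auto simp: diag_chain_def)
  qed (use D in auto)
  moreover have "D $$ (i, i) dvd D $$ (Suc i, Suc i)" if "Suc i < r" for i
    using chain that r_le by (auto simp: diag_chain_def)
  ultimately show ?thesis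
    unfolding smith_shape_def using r_le D
    by (intro exI[of _ r] exI[of _ "\<lambda>i. D $$ (i, i)"]) auto
qed

section \<open>Translation between families and matrices over \<open>QP\<close>, and
  conclusion\<close>

lemma qp_mat_eval: "M \<in> QP_mat k s \<Longrightarrow> qp_mat k s (eval_mat M)"
  by (auto simp: QP_mat_def qp_mat_def eval_mat_def)

lemma QP_mat_of_qp_mat:
  assumes "qp_mat k s F"
  defines "M \<equiv> mat k s (\<lambda>(i, j). \<lambda>n. F n $$ (i, j))"
  shows "M \<in> QP_mat k s" "eval_mat M n = F n"
proof -
  show "M \<in> QP_mat k s"
    using assms(1) by (auto simp: QP_mat_def qp_mat_def M_def)
  show "eval_mat M n = F n"
    using qp_matD[OF assms(1), of n] by (intro eq_matI) (auto simp: eval_mat_def M_def)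
qed

theorem theorem4p6:
  fixes M :: "(int \<Rightarrow> int) mat" and k s :: nat
  assumes "M \<in> QP_mat k s"
  shows "smith_mat_fun M \<in> QP_mat k s \<and>
    (\<exists>U\<in>QP_mat k k. \<exists>V\<in>QP_mat s s.
       (\<forall>\<^sub>F n in at_top. unimodular (eval_mat U n) \<and> unimodular (eval_mat V n)) \<and>
       (\<forall>\<^sub>F n in at_top. eval_mat U n * eval_mat M n * eval_mat V n = smith_normal_form (eval_mat M n)))"
proof -
  have M: "qp_mat k s (eval_mat M)" using assms by (rule qp_mat_eval)
  obtain D where D: "qp_equiv k s (eval_mat M) D" "\<And>n. diag_chain k s (D n)"
    using qp_equiv_diag_chain[OF M] by blast
  obtain U V where UV: "qp_unimodular k U" "qp_unimodular s V" "\<And>n. D n = U n * eval_mat M n * V n"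
    using D(1) by (auto simp: qp_equiv_def)
  have carr: "eval_mat M n \<in> carrier_mat k s" "U n \<in> carrier_mat k k" "V n \<in> carrier_mat s s"
    "D n \<in> carrier_mat k s" for n
    using M UV(1,2) qp_equiv_mat[OF D(1)] by (auto simp: qp_unimodular_def qp_matD)
  have unim: "unimodular (U n)" "unimodular (V n)" for n
    using UV(1,2) carr(2,3)[of n] by (auto simp: qp_unimodular_def unimodular_def)
  \<comment> \<open>This holds at every \<open>n\<close>, so by uniqueness \<open>D\<close> agrees
    everywhere with the Smith normal form, and the entries of \<open>smith_mat_fun M\<close> inherit
    membership in \<open>QP\<close> from \<open>D\<close>.\<close>
  have "is_smith_normal_form (eval_mat M n) (D n)" for n
  proof -
    have "dim_row (eval_mat M n) = k" "dim_col (eval_mat M n) = s" using carr(1)[of n] by auto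
    then show ?thesis
      unfolding is_smith_normal_form_def
      using carr[of n] unim[of n] UV(3)[of n] diag_chain_smith_shape[OF carr(4)[of n] D(2)[of n]]
      by metis
  qed
  then have snf: "smith_normal_form (eval_mat M n) = D n" for n
    by (rule smith_normal_form_eqI)
  have "smith_mat_fun M = mat k s (\<lambda>(i, j). \<lambda>n. D n $$ (i, j))"
    using assms by (auto simp: smith_mat_fun_def snf QP_mat_def)
  with QP_mat_of_qp_mat(1)[OF qp_equiv_mat[OF D(1)]]
  have "smith_mat_fun M \<in> QP_mat k s" by simp
  moreover have "qp_mat k k U" "qp_mat s s V" using UV by (auto simp: qp_unimodular_def)
  note QP_mat_of_qp_mat[OF this(1)] QP_mat_of_qp_mat[OF this(2)]
  ultimately show ?thesis
    using unim UV(3) snf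
    by (intro conjI bexI[of _ "mat k k (\<lambda>(i, j). \<lambda>n. U n $$ (i, j))"]
          bexI[of _ "mat s s (\<lambda>(i, j). \<lambda>n. V n $$ (i, j))"]) auto
qed

end
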